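(* Let $N\ge1$, $\underline d\in\mathbb N^{N+1}$ and $0\le r\le\min\underline d$. Then, as formal power series in $q$, $$Q^r_{\underline d}=\mathcal P_r\cdot\sum_{s=0}^{\min\underline d-r}(-1)^s q^{\binom s2}\,\mathcal P_s\,\mathcal P_{\underline d-r-s},$$ where $\underline d-r-s=(d_0-r-s,\dots,d_N-r-s)$.
   Context: $\mathrm{Rep}_{\underline d}=\prod_{i=1}^N\mathrm{Mat}_{d_i,d_{i-1}}(\mathbb C)$ is the space of tuples $A_*=(A_1,\dots,A_N)$, $A_i$ of size $d_i\times d_{i-1}$. A Kostant partition of $\underline d$ is an array $\underline m=(m_{ij})_{0\le i\le j\le N}$ of nonnegative integers with $d_k=\sum_{i\le k\le j}m_{ij}$ for every $k$; their (finite) set is $\mathcal M^+_{\underline d}$. For $\underline m\in\mathcal M^+_{\underline d}$ put $r_{ij}(\underline m)=\sum_{k\le i,\ j\le l}m_{kl}$ and $\mathcal O_{\underline m}=\{A_*\in\mathrm{Rep}_{\underline d}:\operatorname{rank}(A_jA_{j-1}\cdots A_{i+1})=r_{ij}(\underline m)\ \text{for all }0\le i<j\le N\}$; these are exactly the orbits of $G=\prod_{i=0}^N GL_{d_i}(\mathbb C)$ acting by $(P_i)\cdot A_*=(P_1A_1P_0^{-1},\dots,P_NA_NP_{N-1}^{-1})$. For $s\in\mathbb N$, $\mathcal P_s=\prod_{t=1}^s(1-q^t)^{-1}$ (a formal power series, $\mathcal P_0=1$), and for a finite family $\underline h=(h_i)$ of nonnegative integers $\mathcal P_{\underline h}=\prod_i\mathcal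 P_{h_i}$ (for $\underline m$, the product over all entries $m_{ij}$). Define $Q^r_{\underline d}=\sum_{\underline m\in\mathcal M^+_{\underline d},\ m_{0N}=r}q^{\operatorname{codim}_{\mathrm{Rep}_{\underline d}}\mathcal O_{\underline m}}\mathcal P_{\underline m}$, with complex codimension. *)

theory Defs
  imports "HOL-Analysis.Analysis" "HOL-Computational_Algebra.Formal_Power_Series" "HOL-Library.Function_Algebras"
begin

text \<open>A matrix of size a x b is a function nat => nat => complex vanishing
  outside rows < a and columns < b.\<close>

definition mmult :: "(nat \<Rightarrow> nat \<Rightarrow> complex) \<Rightarrow> (nat \<Rightarrow> nat \<Rightarrow> complex) \<Rightarrow> nat
    \<Rightarrow> (nat \<Rightarrow> nat \<Rightarrow> complex)" where
  "mmult M P n = (\<lambda>a b. \<Sum>t<n. M a t * P t b)"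

definition idmat :: "nat \<Rightarrow> (nat \<Rightarrow> nat \<Rightarrow> complex)" where
  "idmat n = (\<lambda>a b. if a = b \<and> a < n then 1 else 0)"

definition mrank :: "(nat \<Rightarrow> nat \<Rightarrow> complex) \<Rightarrow> nat \<Rightarrow> nat" where
  "mrank M cols = vector_space.dim (\<lambda>(c::complex) (v::nat \<Rightarrow> complex). \<lambda>x. c * v x)
      ((\<lambda>b. \<lambda>a. M a b) ` {..<cols})"

fun chain :: "(nat \<Rightarrow> nat \<Rightarrow> nat \<Rightarrow> complex) \<Rightarrow> (nat \<Rightarrow> nat) \<Rightarrow> nat \<Rightarrow> nat
    \<Rightarrow> (nat \<Rightarrow> nat \<Rightarrow> complex)" where
  "chain A d i 0 = idmat (d i)"
| "chain A d i (Suc k) = mmult (A (i + Suc k)) (chain A d i k) (d (i + k))"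

text \<open>Rep_d: tuples (A_1,...,A_N), A_i of size d_i x d_(i-1), encoded as
  A :: nat => nat => nat => complex with A i a b = 0 unless 1<=i<=N, a<d_i, b<d_(i-1).\<close>
definition Rep :: "nat \<Rightarrow> (nat \<Rightarrow> nat) \<Rightarrow> (nat \<Rightarrow> nat \<Rightarrow> nat \<Rightarrow> complex) set" where
  "Rep N d = {A. \<forall>i a b. A i a b \<noteq> 0 \<longrightarrow> 1 \<le> i \<and> i \<le> N \<and> a < d i \<and> b < d (i - 1)}"

definition dimRep :: "nat \<Rightarrow> (nat \<Rightarrow> nat) \<Rightarrow> nat" where
  "dimRep N d = (\<Sum>i\<in>{1..N}. d i * d (i - 1))"

definition kostant :: "nat \<Rightarrow> (nat \<Rightarrow> nat) \<Rightarrow> (nat \<Rightarrow> nat \<Rightarrow> nat) set" where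
  "kostant N d = {m. (\<forall>i j. m i j \<noteq> 0 \<longrightarrow> i \<le> j \<and> j \<le> N) \<and>
      (\<forall>k\<le>N. d k = (\<Sum>i\<in>{..k}. \<Sum>j\<in>{k..N}. m i j))}"

definition rk :: "nat \<Rightarrow> (nat \<Rightarrow> nat \<Rightarrow> nat) \<Rightarrow> nat \<Rightarrow> nat \<Rightarrow> nat" where
  "rk N m i j = (\<Sum>k\<in>{..i}. \<Sum>l\<in>{j..N}. m k l)"

definition orbit :: "nat \<Rightarrow> (nat \<Rightarrow> nat) \<Rightarrow> (nat \<Rightarrow> nat \<Rightarrow> nat) \<Rightarrow> (nat \<Rightarrow> nat \<Rightarrow> nat \<Rightarrow> complex) set" where
  "orbit N d m = {A \<in> Rep N d. \<forall>i j. i < j \<and> j \<le> N \<longrightarrow>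
      mrank (chain A d i (j - i)) (d i) = rk N m i j}"

definition locally_euclidean_dim :: "'a topology \<Rightarrow> nat \<Rightarrow> bool" where
  "locally_euclidean_dim X k \<longleftrightarrow> (\<forall>x\<in>topspace X. \<exists>U V. openin X U \<and> x \<in> U \<and>
      openin (Euclidean_space k) V \<and> subtopology X U homeomorphic_space subtopology (Euclidean_space k) V)"

text \<open>Complex codimension of an orbit in Rep_d (orbits are complex manifolds; the
  real dimension is twice the complex dimension).  The topology on Rep_d is the
  Euclidean one (product topology on the finitely many coordinates).\<close>
definition codim :: "nat \<Rightarrow> (nat \<Rightarrow> nat) \<Rightarrow> (nat \<Rightarrow> nat \<Rightarrow> nat \<Rightarrow> complex) set \<Rightarrow> nat" where
  "codim N d S = dimRep N d - (THE k. locally_euclidean_dim (top_of_set S) k) div 2"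

definition PP :: "nat \<Rightarrow> rat fps" where
  "PP s = (\<Prod>t\<in>{1..s}. inverse (1 - fps_X ^ t))"

definition PPm :: "nat \<Rightarrow> (nat \<Rightarrow> nat \<Rightarrow> nat) \<Rightarrow> rat fps" where
  "PPm N m = (\<Prod>i\<in>{..N}. \<Prod>j\<in>{i..N}. PP (m i j))"

definition Qr :: "nat \<Rightarrow> (nat \<Rightarrow> nat) \<Rightarrow> nat \<Rightarrow> rat fps" where
  "Qr N d r = (\<Sum>m\<in>{m\<in>kostant N d. m 0 N = r}. fps_X ^ codim N d (orbit N d m) * PPm N m)"

definition mind :: "nat \<Rightarrow> (nat \<Rightarrow> nat) \<Rightarrow> nat" where
  "mind N d = Min (d ` {..N})"

end

theory Submission
  imports Defs "HOL-Homology.Invariance_of_Domain" "Jordan_Normal_Form.Determinant"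
begin

text \<open>
  The codimension of the orbit of \<open>m\<close> is \<open>\<Sum>\<^bsub>i \<le> n < N\<^esub> m\<^bsub>i,n\<^esub> (d\<^bsub>n+1\<^esub> - r\<^bsub>i,n+1\<^esub>)\<close>.  Near a point \<open>A\<close> of the orbit
  choose successively bases of the spaces: the \<open>(n+1)\<close>-st basis consists of the images under
  \<open>A\<^bsub>n+1\<^esub>\<close> of those vectors of the \<open>n\<close>-th one that are not in the span of the earlier images, completed by
  constant unit vectors.  Order each basis by birth, so that its first \<open>r\<^bsub>i,n\<^esub>\<close> vectors span the image of
  \<open>A\<^bsub>n\<^esub> \<cdots> A\<^bsub>i+1\<^esub>\<close>.  The images of the selected vectors are free coordinates; the image of a
  vector that is not selected and has birth \<open>i\<close> is a free combination of the first \<open>r\<^bsub>i,n+1\<^esub>\<close> new basis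
  vectors.  These coordinates identify a neighbourhood of \<open>A\<close> in the orbit with an open
  subset of a complex vector space; invariance of domain makes its dimension unique.

  With this codimension, removing the last space turns the sum over all Kostant partitions of
  \<open>d\<close> into iterated Durfee rectangle identities, so that it equals \<open>\<Prod>\<^bsub>k\<^esub> PP (d k)\<close>.  The entry \<open>m\<^bsub>0,N\<^esub>\<close>
  does not affect the codimension, whence \<open>\<Prod>\<^bsub>k\<^esub> PP (d k) = \<Sum>\<^bsub>r\<^esub> PP r * Q\<^sup>0\<^bsub>d-r\<^esub>\<close>, and
  Euler's identity inverts this relation.
\<close>

section \<open>The sum over all Kostant partitions\<close>

lemma PP_0 [simp]: "PP 0 = 1"
  by (simp add: PP_def)

lemma PP_Suc: "PP (Suc s) * (1 - fps_X ^ Suc s) = PP s"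
proof -
  have "inverse (1 - fps_X ^ Suc s) * (1 - fps_X ^ Suc s) = (1 :: rat fps)"
    by (rule inverse_mult_eq_1) simp
  then show ?thesis
    by (simp add: PP_def prod.nat_ivl_Suc' mult.assoc)
qed

lemma PP_pred: "PP a * (1 - fps_X ^ a) = (if a = 0 then 0 else PP (a - 1))"
  using PP_Suc[of "a - 1"] by (cases a) auto

lemma one_minus_fps_X_power_nonzero:
  assumes "k > 0"
  shows "1 - fps_X ^ k \<noteq> (0 :: rat fps)"
proof
  assume *: "1 - fps_X ^ k = (0 :: rat fps)"
  have "fps_nth (1 - fps_X ^ k :: rat fps) 0 = 1" using assms by simp
  then show False unfolding * by simp
qed

text \<open>Induction on \<open>u\<close> after multiplying by \<open>1 - q^(u+1)\<close>, split as
  \<open>(1 - q^a) + q^a (1 - q^(u+1-a))\<close>. The first part cancels a factor of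
  \<open>PP a\<close> and leaves the summand for \<open>u\<close>, \<open>e - 1\<close>,
  \<open>a - 1\<close>. The second cancels a factor of \<open>PP (u + 1 - a)\<close> and leaves
  \<open>q^e\<close> times the summand for \<open>u\<close>, \<open>e\<close>, \<open>a\<close>. By
  induction the two sums are \<open>PP u * PP e * (1 - q^e)\<close> and
  \<open>q^e * PP u * PP e\<close>, which add up to \<open>PP u * PP e\<close>; the nonzero factor
  is then cancelled.\<close>

lemma durfee_rectangle:
  "(\<Sum>a\<in>{..min u e}. fps_X ^ ((u - a) * (e - a)) * PP a * PP (u - a) * PP (e - a)) = PP u * PP e"
proof (induction u arbitrary: e)
  case 0
  then show ?case by simp
next
  case (Suc u)
  let ?q = "fps_X :: rat fps"
  define F where "F u e a = ?q ^ ((u - a) * (e - a)) * PP a * PP (u - a) * PP (e - a)" for u e a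
  have ext: "(\<Sum>a\<in>{..min v e}. F v e a) = (\<Sum>a\<in>{a. a \<le> v \<and> a \<le> e}. F v e a)" for v e
    by (rule sum.cong) auto
  have IH: "(\<Sum>a\<in>{a. a \<le> u \<and> a \<le> e}. F u e a) = PP u * PP e" for e
    using Suc[of e] ext[of u e] by (simp add: F_def)
  have fin: "finite {a. a \<le> v \<and> a \<le> (w::nat)}" for v w
    by (rule finite_subset[of _ "{..v}"]) auto
  have step: "F (Suc u) e a * (1 - ?q ^ Suc u) =
      (if a = 0 then 0 else F u (e - 1) (a - 1)) + (if a = Suc u then 0 else ?q ^ e * F u e a)"
    if "a \<le> Suc u" "a \<le> e" for a
  proof -
    have split: "(1 - ?q ^ Suc u) = (1 - ?q ^ a) + ?q ^ a * (1 - ?q ^ (Suc u - a))"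
      using that by (simp add: algebra_simps flip: power_add)
    have "F (Suc u) e a * (1 - ?q ^ Suc u) =
        ?q ^ ((Suc u - a) * (e - a)) * (PP a * (1 - ?q ^ a)) * PP (Suc u - a) * PP (e - a)
       + ?q ^ ((Suc u - a) * (e - a) + a) * PP a * (PP (Suc u - a) * (1 - ?q ^ (Suc u - a))) * PP (e - a)"
      unfolding F_def split by (simp only: power_add) (simp add: algebra_simps)
    also have "?q ^ ((Suc u - a) * (e - a)) * (PP a * (1 - ?q ^ a)) * PP (Suc u - a) * PP (e - a)
        = (if a = 0 then 0 else F u (e - 1) (a - 1))"
      unfolding PP_pred using that by (cases a) (auto simp: F_def)
    also have "?q ^ ((Suc u - a) * (e - a) + a) * PP a * (PP (Suc u - a) * (1 - ?q ^ (Suc u - a))) * PP (e - a)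
        = (if a = Suc u then 0 else ?q ^ e * F u e a)"
    proof (cases "a = Suc u")
      case True
      then show ?thesis by (simp add: PP_pred)
    next
      case False
      then have "(Suc u - a) * (e - a) + a = e + (u - a) * (e - a)"
        using that by (simp add: Suc_diff_le)
      then have "?q ^ ((Suc u - a) * (e - a) + a) = ?q ^ e * ?q ^ ((u - a) * (e - a))"
        by (simp add: power_add)
      then show ?thesis using False that
        by (simp only: PP_pred F_def) (simp add: Suc_diff_le ac_simps)
    qed
    finally show ?thesis .
  qed
  have "(\<Sum>a\<in>{a. a \<le> Suc u \<and> a \<le> e}. F (Suc u) e a) * (1 - ?q ^ Suc u)
     = (\<Sum>a\<in>{a. a \<le> Suc u \<and> a \<le> e}. if a = 0 then 0 else F u (e - 1) (a - 1))
     + (\<Sum>a\<in>{a. a \<le> Suc u \<and> a \<le> e}. if a = Suc u then 0 else ?q ^ e * F u e a)"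
    unfolding sum_distrib_right sum.distrib[symmetric] by (rule sum.cong[OF refl]) (use step in auto)
  also have "(\<Sum>a\<in>{a. a \<le> Suc u \<and> a \<le> e}. if a = Suc u then 0 else ?q ^ e * F u e a)
     = (\<Sum>a\<in>{a. a \<le> u \<and> a \<le> e}. ?q ^ e * F u e a)"
    by (rule sum.mono_neutral_cong_right[OF fin]) (auto simp: le_Suc_eq)
  also have "\<dots> = ?q ^ e * (PP u * PP e)"
    by (simp add: IH flip: sum_distrib_left)
  also have "(\<Sum>a\<in>{a. a \<le> Suc u \<and> a \<le> e}. if a = 0 then 0 else F u (e - 1) (a - 1))
      = PP u * (PP e * (1 - ?q ^ e))"
  proof (cases e)
    case 0
    then show ?thesis by (auto intro!: sum.neutral)
  next
    case (Suc e')
    have "(\<Sum>a\<in>{a. a \<le> Suc u \<and> a \<le> e}. if a = 0 then 0 else F u (e - 1) (a - 1))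
        = (\<Sum>a\<in>Suc ` {a. a \<le> u \<and> a \<le> e'}. F u e' (a - 1))"
    proof (rule sum.mono_neutral_cong_right[OF fin])
      show "\<forall>i\<in>{a. a \<le> Suc u \<and> a \<le> e} - Suc ` {a. a \<le> u \<and> a \<le> e'}.
          (if i = 0 then 0 else F u (e - 1) (i - 1)) = 0"
      proof
        fix i assume "i \<in> {a. a \<le> Suc u \<and> a \<le> e} - Suc ` {a. a \<le> u \<and> a \<le> e'}"
        then show "(if i = 0 then 0 else F u (e - 1) (i - 1)) = 0"
          using Suc by (cases i) auto
      qed
    qed (use Suc in auto)
    also have "\<dots> = PP u * PP e'"
      by (subst sum.reindex) (auto simp: IH)
    finally show ?thesis using Suc by (simp add: PP_pred del: power_Suc)
  qed
  finally have *: "(\<Sum>a\<in>{a. a \<le> Suc u \<and> a \<le> e}. F (Suc u) e a) * (1 - ?q ^ Suc u) = PP u * PP e"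
    by (simp add: algebra_simps)
  have "\<dots> = PP (Suc u) * PP e * (1 - ?q ^ Suc u)"
    unfolding PP_Suc[of u, symmetric] by (simp only: ac_simps)
  with * have "(\<Sum>a\<in>{a. a \<le> Suc u \<and> a \<le> e}. F (Suc u) e a) * (1 - ?q ^ Suc u)
      = PP (Suc u) * PP e * (1 - ?q ^ Suc u)" by simp
  moreover have "1 - ?q ^ Suc u \<noteq> 0"
  by (rule one_minus_fps_X_power_nonzero) simp
  ultimately have "(\<Sum>a\<in>{a. a \<le> Suc u \<and> a \<le> e}. F (Suc u) e a) = PP (Suc u) * PP e"
    using mult_right_cancel by blast
  then show ?case using ext[of "Suc u" e] by (simp add: F_def)
qed

text \<open>Euler: the generating series of \<open>PP\<close> and of its signed \<open>q\<close>-shift are inverse to each other.\<close>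

lemma euler_inversion:
  "(\<Sum>s\<le>n. (-1) ^ s * fps_X ^ (s choose 2) * PP s * PP (n - s)) = (if n = 0 then 1 else 0)"
proof (cases n)
  case 0
  then show ?thesis by (simp add: numeral_2_eq_2)
next
  case (Suc n')
  let ?q = "fps_X :: rat fps"
  \<comment> \<open>After multiplication by \<open>1 - q^n\<close> the sum telescopes: the s-th
    summand becomes \<open>G (Suc s) - G s\<close>. The value \<open>G 0 = 0\<close> reflects that
    \<open>1 - q^s\<close> vanishes at s = 0. The case s = n is kept apart because truncated
    subtraction would make \<open>G (Suc n)\<close> nonzero, whereas the corresponding term is
    zero.\<close>
  define G where "G t = (if t = 0 then 0 else
      (-1) ^ (t - 1) * ?q ^ (t choose 2) * PP (t - 1) * PP (n - t) :: rat fps)" for t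
  have ch: "(Suc s choose 2) = (s choose 2) + s" for s
    by (simp add: numeral_2_eq_2)
  have step: "(-1) ^ s * ?q ^ (s choose 2) * PP s * PP (n - s) * (1 - ?q ^ n) 
      = (if s = n then 0 else G (Suc s)) - G s" if "s \<le> n" for s
  proof -
    have split: "(1 - ?q ^ n) = (1 - ?q ^ s) + ?q ^ s * (1 - ?q ^ (n - s))"
      using that by (simp add: algebra_simps flip: power_add)
    have "(-1) ^ s * ?q ^ (s choose 2) * PP s * PP (n - s) * (1 - ?q ^ n)
      = (-1) ^ s * ?q ^ (s choose 2) * (PP s * (1 - ?q ^ s)) * PP (n - s)
      + (-1) ^ s * ?q ^ ((s choose 2) + s) * PP s * (PP (n - s) * (1 - ?q ^ (n - s)))"
      unfolding split by (simp only: power_add) (simp add: algebra_simps)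
    also have "(-1) ^ s * ?q ^ (s choose 2) * (PP s * (1 - ?q ^ s)) * PP (n - s) = - G s"
      unfolding PP_pred G_def by (cases s) auto
    also have "(-1) ^ s * ?q ^ ((s choose 2) + s) * PP s * (PP (n - s) * (1 - ?q ^ (n - s)))
        = (if s = n then 0 else G (Suc s))"
      unfolding PP_pred G_def ch using that by auto
    finally show ?thesis by simp
  qed
  have "(\<Sum>s\<le>n. (-1) ^ s * ?q ^ (s choose 2) * PP s * PP (n - s)) * (1 - ?q ^ n)
      = (\<Sum>s\<le>n. (if s = n then 0 else G (Suc s)) - G s)"
    unfolding sum_distrib_right by (rule sum.cong[OF refl]) (use step in auto)
  also have "\<dots> = (\<Sum>s<n. G (Suc s)) - (\<Sum>s\<le>n. G s)"
    unfolding sum_subtractf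
    by (rule arg_cong2[where f = minus], rule sum.mono_neutral_cong_right) auto
  also have "\<dots> = 0"
    by (simp add: sum.atMost_shift) (simp add: G_def)
  finally have "(\<Sum>s\<le>n. (-1) ^ s * ?q ^ (s choose 2) * PP s * PP (n - s)) * (1 - ?q ^ n) = 0" .
  moreover have "1 - ?q ^ n \<noteq> 0"
  by (rule one_minus_fps_X_power_nonzero) (simp add: Suc)
  ultimately have "(\<Sum>s\<le>n. (-1) ^ s * ?q ^ (s choose 2) * PP s * PP (n - s)) = 0"
    using mult_eq_0_iff by blast
  then show ?thesis using Suc by (simp only:) simp
qed

section \<open>Iterated Durfee rectangles: distributing several blocks into one new space\<close>

definition cuts :: "nat \<Rightarrow> (nat \<Rightarrow> nat) \<Rightarrow> nat \<Rightarrow> (nat \<Rightarrow> nat) set" where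
  "cuts K u e = {a. (\<forall>i<K. a i \<le> u i) \<and> (\<forall>i\<ge>K. a i = 0) \<and> (\<Sum>i<K. a i) \<le> e}"

lemma finite_cuts: "finite (cuts K u e)"
proof (rule finite_subset)
  show "cuts K u e \<subseteq> {a. \<forall>i. (i \<in> {..<K} \<longrightarrow> a i \<in> {..e}) \<and> (i \<notin> {..<K} \<longrightarrow> a i = 0)}"
  proof clarify
    fix a i assume a: "a \<in> cuts K u e"
    have "a i \<le> (\<Sum>i<K. a i)" if "i < K" using that by (intro member_le_sum) auto
    with a show "(i \<in> {..<K} \<longrightarrow> a i \<in> {..e}) \<and> (i \<notin> {..<K} \<longrightarrow> a i = 0)"
      by (auto simp: cuts_def)
  qed
qed (rule finite_set_of_finite_funs; simp)

text \<open>An element \<open>a\<close> of \<open>cuts\<close> records how many of the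
  \<open>u i\<close> intervals born at i are prolonged into a new space of dimension
  \<open>e\<close>; the remaining \<open>e - sum a\<close> dimensions are born there. Summing over
  the last entry first is one Durfee identity with \<open>e\<close> replaced by what the earlier
  entries leave over. It produces \<open>PP (u K)\<close> and restores the last factor of the sum
  for K blocks.\<close>

lemma sum_cuts:
  "(\<Sum>a\<in>cuts K u e. fps_X ^ (\<Sum>i<K. (u i - a i) * (e - (\<Sum>k\<le>i. a k))) *
      (\<Prod>i<K. PP (a i) * PP (u i - a i)) * PP (e - (\<Sum>i<K. a i)))
   = (\<Prod>i<K. PP (u i)) * PP e"
proof (induction K)
  case 0
  have "cuts 0 u e = {\<lambda>_. 0}" by (auto simp: cuts_def)
  then show ?case by simp
next
  case (Suc K)
  define w where "w K a = fps_X ^ (\<Sum>i<K. (u i - a i) * (e - (\<Sum>k\<le>i. a k))) *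
      (\<Prod>i<K. PP (a i) * PP (u i - a i))" for K and a :: "nat \<Rightarrow> nat"
  let ?S = "Sigma (cuts K u e) (\<lambda>a. {..min (u K) (e - (\<Sum>i<K. a i))})"
  have upd: "sum (a(K := b)) A = sum a A" if "K \<notin> A" for a :: "nat \<Rightarrow> nat" and b A
    using that by (intro sum.cong) auto
  have wupd: "w K (a(K := b)) = w K a" for a b
    unfolding w_def
    by (intro arg_cong2[where f = "(*)"] arg_cong2[where f = "power"] sum.cong prod.cong refl) (auto simp: upd)
  have "(\<Sum>a\<in>cuts (Suc K) u e. w (Suc K) a * PP (e - (\<Sum>i<Suc K. a i)))
     = (\<Sum>(a, b)\<in>?S. w K a * (fps_X ^ ((u K - b) * (e - (\<Sum>i<K. a i) - b)) * PP b * PP (u K - b)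
          * PP (e - (\<Sum>i<K. a i) - b)))"
  proof (rule sum.reindex_bij_witness[of _ "\<lambda>(a, b). a(K := b)" "\<lambda>a. (a(K := 0), a K)"])
    fix a assume a: "a \<in> cuts (Suc K) u e"
    show "(case (a(K := 0), a K) of (a, b) \<Rightarrow> a(K := b)) = a" by simp
    show "(a(K := 0), a K) \<in> ?S"
      using a by (auto simp: cuts_def upd less_Suc_eq)
    have "w (Suc K) a = w K a * fps_X ^ ((u K - a K) * (e - (\<Sum>i<K. a i) - a K)) * (PP (a K) * PP (u K - a K))"
      by (simp add: w_def power_add ac_simps flip: lessThan_Suc_atMost)
    then show "(case (a(K := 0), a K) of (a, b) \<Rightarrow> w K a * (fps_X ^ ((u K - b) * (e - (\<Sum>i<K. a i) - b)) * PP b * PP (u K - b)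
          * PP (e - (\<Sum>i<K. a i) - b))) = w (Suc K) a * PP (e - (\<Sum>i<Suc K. a i))"
      by (simp add: wupd upd ac_simps)
  next
    fix b assume b: "b \<in> ?S"
    show "(case b of (a, b) \<Rightarrow> a(K := b)) \<in> cuts (Suc K) u e"
      using b by (auto simp: cuts_def upd less_Suc_eq)
    show "((case b of (a, b) \<Rightarrow> a(K := b))(K := 0), (case b of (a, b) \<Rightarrow> a(K := b)) K) = b"
      using b by (auto simp: cuts_def fun_eq_iff)
  qed
  also have "\<dots> = (\<Sum>a\<in>cuts K u e. w K a * (PP (u K) * PP (e - (\<Sum>i<K. a i))))"
    by (subst sum.Sigma[symmetric, OF finite_cuts])
       (simp_all only: finite_atMost sum_distrib_left[symmetric] durfee_rectangle ball_triv simp_thms)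
  also have "\<dots> = PP (u K) * (\<Sum>a\<in>cuts K u e. w K a * PP (e - (\<Sum>i<K. a i)))"
    by (simp add: sum_distrib_left ac_simps)
  also have "\<dots> = PP (u K) * ((\<Prod>i<K. PP (u i)) * PP e)"
    using Suc by (simp add: w_def)
  finally show ?case by (simp add: w_def ac_simps)
qed

section \<open>Kostant partitions and removal of the last space\<close>

definition cdim :: "nat \<Rightarrow> (nat \<Rightarrow> nat) \<Rightarrow> (nat \<Rightarrow> nat \<Rightarrow> nat) \<Rightarrow> nat" where
  "cdim N d m = (\<Sum>n<N. \<Sum>i\<le>n. m i n * (d (Suc n) - rk N m i (Suc n)))"

lemma kostant_rk: "m \<in> kostant N d \<Longrightarrow> k \<le> N \<Longrightarrow> rk N m k k = d k"
  by (simp add: kostant_def rk_def)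

lemma kostant_zero: "m \<in> kostant N d \<Longrightarrow> \<not> (i \<le> j \<and> j \<le> N) \<Longrightarrow> m i j = 0"
  by (auto simp: kostant_def)

lemma finite_kostant: "finite (kostant N d)"
proof (rule finite_subset)
  let ?B = "Max (d ` {..N})"
  let ?F = "{f. \<forall>j. (j \<in> {..N} \<longrightarrow> f j \<in> {..?B}) \<and> (j \<notin> {..N} \<longrightarrow> f j = (0::nat))}"
  show "kostant N d \<subseteq> {m. \<forall>i. (i \<in> {..N} \<longrightarrow> m i \<in> ?F) \<and> (i \<notin> {..N} \<longrightarrow> m i = (\<lambda>_. 0))}"
  proof clarify
    fix m i assume m: "m \<in> kostant N d"
    have "m i j \<le> ?B" if "i \<le> j" "j \<le> N" for j
    proof -
      have "m i j \<le> (\<Sum>l\<in>{i..N}. m i l)" by (rule member_le_sum) (use that in auto)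
      also have "\<dots> \<le> (\<Sum>k\<le>i. \<Sum>l\<in>{i..N}. m k l)" by (rule member_le_sum[of i "{..i}" "\<lambda>k. \<Sum>l\<in>{i..N}. m k l"]) auto
      also have "\<dots> = d i" using m that by (simp add: kostant_def)
      also have "\<dots> \<le> ?B" using that by simp
      finally show ?thesis .
    qed
    moreover have "m i j = 0" if "\<not> (i \<le> j \<and> j \<le> N)" for j
      using kostant_zero[OF m that] .
    ultimately have "m i j \<le> ?B" "j > N \<Longrightarrow> m i j = 0" "i > N \<Longrightarrow> m i j = 0" for j
      by (metis zero_le, simp, simp)
    then show "(i \<in> {..N} \<longrightarrow> m i \<in> ?F) \<and> (i \<notin> {..N} \<longrightarrow> m i = (\<lambda>_. 0))"
      by (simp add: fun_eq_iff)
  qed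
  show "finite {m. \<forall>i. (i \<in> {..N} \<longrightarrow> m i \<in> ?F) \<and> (i \<notin> {..N} \<longrightarrow> m i = (\<lambda>_. 0))}"
    by (intro finite_set_of_finite_funs finite_atMost)
qed

text \<open>On representations this is restriction to the spaces 0, ..., N: an interval ending at N
  + 1 is cut back to end at N, and one that lives only at N + 1 disappears.\<close>

definition merge_last :: "nat \<Rightarrow> (nat \<Rightarrow> nat \<Rightarrow> nat) \<Rightarrow> nat \<Rightarrow> nat \<Rightarrow> nat" where
  "merge_last N m i j = (if i \<le> N \<and> j < N then m i j
     else if i \<le> N \<and> j = N then m i N + m i (Suc N) else 0)"

text \<open>Reverses \<open>merge_last\<close>: of the intervals from i to N, \<open>a i\<close> are
  prolonged to N + 1, and new intervals at N + 1 fill its dimension up to \<open>e\<close>.\<close>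

definition split_last :: "nat \<Rightarrow> nat \<Rightarrow> (nat \<Rightarrow> nat \<Rightarrow> nat) \<Rightarrow> (nat \<Rightarrow> nat) \<Rightarrow> nat \<Rightarrow> nat \<Rightarrow> nat" where
  "split_last N e m a i j = (if j < N then m i j else if j = N then m i N - a i
     else if j = Suc N then (if i = Suc N then e - (\<Sum>k<Suc N. a k) else a i) else 0)"

lemma sum_merge_last:
  assumes "i \<le> N" "j \<le> N"
  shows "(\<Sum>l\<in>{j..N}. merge_last N m i l) = (\<Sum>l\<in>{j..Suc N}. m i l)"
proof -
  have "(\<Sum>l\<in>{j..<N}. merge_last N m i l) = (\<Sum>l\<in>{j..<N}. m i l)"
    using assms by (intro sum.cong) (auto simp: merge_last_def)
  moreover have "{j..N} = insert N {j..<N}" "{j..Suc N} = insert (Suc N) (insert N {j..<N})"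
    using assms by auto
  ultimately show ?thesis using assms by (simp add: merge_last_def)
qed

lemma rk_merge_last:
  assumes "i \<le> N" "j \<le> N"
  shows "rk N (merge_last N m) i j = rk (Suc N) m i j"
  unfolding rk_def using assms by (intro sum.cong refl sum_merge_last) auto

lemma merge_last_kostant:
  assumes "m \<in> kostant (Suc N) d"
  shows "merge_last N m \<in> kostant N d"
proof -
  have "d k = (\<Sum>i\<le>k. \<Sum>j\<in>{k..N}. merge_last N m i j)" if "k \<le> N" for k
  proof -
    have "(\<Sum>i\<le>k. \<Sum>j\<in>{k..N}. merge_last N m i j) = (\<Sum>i\<le>k. \<Sum>j\<in>{k..Suc N}. m i j)"
      using that by (intro sum.cong refl sum_merge_last) auto
    also have "\<dots> = d k" using kostant_rk[OF assms, of k] that by (simp add: rk_def)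
    finally show ?thesis ..
  qed
  moreover have "merge_last N m i j \<noteq> 0 \<longrightarrow> i \<le> j \<and> j \<le> N" for i j
  proof -
    have "m i j \<noteq> 0 \<longrightarrow> i \<le> j" using assms unfolding kostant_def by blast
    then show ?thesis by (auto simp: merge_last_def)
  qed
  ultimately show ?thesis unfolding kostant_def by blast
qed

lemma merge_split_last:
  assumes m: "m \<in> kostant N d" and a: "a \<in> cuts (Suc N) (\<lambda>i. m i N) e"
  shows "merge_last N (split_last N e m a) = m"
proof (intro ext)
  fix i j
  have 1: "a i \<le> m i N" using a by (cases "i < Suc N") (auto simp: cuts_def)
  have 2: "m i j = 0" if "\<not> (i \<le> j \<and> j \<le> N)" using kostant_zero[OF m that] .
  show "merge_last N (split_last N e m a) i j = m i j"
  proof (cases "i \<le> N \<and> j \<le> N")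
    case True
    then show ?thesis using 1 by (auto simp: merge_last_def split_last_def)
  next
    case False
    then show ?thesis using 2 by (auto simp: merge_last_def)
  qed
qed

lemma split_last_kostant:
  assumes m: "m \<in> kostant N d" and a: "a \<in> cuts (Suc N) (\<lambda>i. m i N) (d (Suc N))"
  shows "split_last N (d (Suc N)) m a \<in> kostant (Suc N) d"
proof -
  let ?m = "split_last N (d (Suc N)) m a"
  have a0: "a i = 0" if "i > N" for i using a that by (auto simp: cuts_def)
  have 1: "?m i j \<noteq> 0 \<longrightarrow> i \<le> j \<and> j \<le> Suc N" for i j
    using kostant_zero[OF m, of i j] kostant_zero[OF m, of i N] a0[of i]
    by (cases "i \<le> j \<and> j \<le> N"; cases "i \<le> N") (auto simp: split_last_def split: if_splits)
  have 2: "d k = (\<Sum>i\<le>k. \<Sum>j\<in>{k..Suc N}. ?m i j)" if "k \<le> N" for k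
  proof -
    have "d k = (\<Sum>i\<le>k. \<Sum>j\<in>{k..N}. merge_last N ?m i j)"
      unfolding merge_split_last[OF m a] using m that by (simp add: kostant_def)
    also have "\<dots> = (\<Sum>i\<le>k. \<Sum>j\<in>{k..Suc N}. ?m i j)"
      using that by (intro sum.cong refl sum_merge_last) auto
    finally show ?thesis .
  qed
  have 3: "d (Suc N) = (\<Sum>i\<le>Suc N. \<Sum>j\<in>{Suc N..Suc N}. ?m i j)"
    using a by (simp add: split_last_def cuts_def lessThan_Suc_atMost)
  have "d k = (\<Sum>i\<le>k. \<Sum>j\<in>{k..Suc N}. ?m i j)" if "k \<le> Suc N" for k
    using that 2[of k] 3 unfolding le_Suc_eq by blast
  with 1 show ?thesis unfolding kostant_def by blast
qed

lemma split_merge_last: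
  assumes m: "m \<in> kostant (Suc N) d"
  defines "a \<equiv> (\<lambda>i. if i \<le> N then m i (Suc N) else 0)"
  shows "a \<in> cuts (Suc N) (\<lambda>i. merge_last N m i N) (d (Suc N))"
    and "split_last N (d (Suc N)) (merge_last N m) a = m"
proof -
  have dN: "d (Suc N) = (\<Sum>i\<le>N. m i (Suc N)) + m (Suc N) (Suc N)"
    using m by (auto simp: kostant_def)
  have sa: "(\<Sum>i<Suc N. a i) = (\<Sum>i\<le>N. m i (Suc N))"
    unfolding lessThan_Suc_atMost by (intro sum.cong) (auto simp: a_def)
  show "a \<in> cuts (Suc N) (\<lambda>i. merge_last N m i N) (d (Suc N))"
    unfolding cuts_def mem_Collect_eq sa dN by (auto simp: a_def merge_last_def)
  show "split_last N (d (Suc N)) (merge_last N m) a = m"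
    unfolding split_last_def sa dN using kostant_zero[OF m]
    by (auto simp: fun_eq_iff merge_last_def a_def)
qed

text \<open>Merging preserves all ranks among the first spaces, so only the terms with n = N are
  new. They form exactly the exponent in \<open>sum_cuts\<close>, as \<open>m i N\<close> counts the
  intervals that are not prolonged.\<close>

lemma cdim_Suc:
  assumes m: "m \<in> kostant (Suc N) d"
  shows "cdim (Suc N) d m = cdim N d (merge_last N m)
    + (\<Sum>i<Suc N. m i N * (d (Suc N) - (\<Sum>k\<le>i. m k (Suc N))))"
proof -
  have "(\<Sum>n<N. \<Sum>i\<le>n. m i n * (d (Suc n) - rk (Suc N) m i (Suc n))) = cdim N d (merge_last N m)"
    unfolding cdim_def
    by (intro sum.cong refl) (auto simp: rk_merge_last merge_last_def)
  moreover have "rk (Suc N) m i (Suc N) = (\<Sum>k\<le>i. m k (Suc N))" for i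
    by (simp add: rk_def)
  ultimately show ?thesis
    unfolding cdim_def sum.lessThan_Suc[of _ N] by (simp add: lessThan_Suc_atMost[symmetric])
qed

lemma PPm_Suc:
  "PPm (Suc N) m = (\<Prod>i<Suc N. \<Prod>j\<in>{i..<N}. PP (m i j)) *
     (\<Prod>i<Suc N. PP (m i (Suc N)) * PP (m i N)) * PP (m (Suc N) (Suc N))"
proof -
  have "(\<Prod>j\<in>{i..Suc N}. PP (m i j)) = (\<Prod>j\<in>{i..<N}. PP (m i j)) * (PP (m i (Suc N)) * PP (m i N))"
    if "i < Suc N" for i
  proof -
    have "{i..Suc N} = insert (Suc N) (insert N {i..<N})" using that by auto
    then show ?thesis by (simp add: ac_simps)
  qed
  then have "(\<Prod>i<Suc N. \<Prod>j\<in>{i..Suc N}. PP (m i j))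
      = (\<Prod>i<Suc N. (\<Prod>j\<in>{i..<N}. PP (m i j)) * (PP (m i (Suc N)) * PP (m i N)))"
    by (intro prod.cong) auto
  then show ?thesis
    unfolding PPm_def prod.distrib[symmetric] lessThan_Suc_atMost[symmetric] prod.lessThan_Suc[of _ "Suc N"]
    by simp
qed

lemma PPm_last:
  "PPm N m = (\<Prod>i<Suc N. \<Prod>j\<in>{i..<N}. PP (m i j)) * (\<Prod>i<Suc N. PP (m i N))"
proof -
  have "(\<Prod>j\<in>{i..N}. PP (m i j)) = (\<Prod>j\<in>{i..<N}. PP (m i j)) * PP (m i N)" if "i < Suc N" for i
  proof -
    have "{i..N} = insert N {i..<N}" using that by auto
    then show ?thesis by (simp add: ac_simps)
  qed
  then show ?thesis
    unfolding PPm_def prod.distrib[symmetric] lessThan_Suc_atMost[symmetric] by simp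
qed

text \<open>A partition for N + 1 corresponds to a partition for N together with a cut of its
  intervals ending at N. For a fixed partition the sum over cuts is \<open>sum_cuts\<close>: it
  returns the factors \<open>PP (m i N)\<close> that complete \<open>PPm N m\<close>, times
  \<open>PP (d (Suc N))\<close>.\<close>

lemma sum_kostant:
  "(\<Sum>m\<in>kostant N d. fps_X ^ cdim N d m * PPm N m) = (\<Prod>k\<le>N. PP (d k))"
proof (induction N)
  case 0
  have "kostant 0 d = {\<lambda>i j. if i = 0 \<and> j = 0 then d 0 else 0}"
  proof (intro Set.set_eqI iffI)
    fix m assume "m \<in> kostant 0 d"
    then have "\<And>i j. \<not> (i = 0 \<and> j = 0) \<Longrightarrow> m i j = 0" "m 0 0 = d 0"
      by (auto simp: kostant_def)
    then show "m \<in> {\<lambda>i j. if i = 0 \<and> j = 0 then d 0 else 0}" by (auto simp: fun_eq_iff)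
  qed (auto simp: kostant_def)
  then show ?case by (simp add: cdim_def PPm_def)
next
  case (Suc N)
  let ?e = "d (Suc N)"
  let ?S = "Sigma (kostant N d) (\<lambda>m. cuts (Suc N) (\<lambda>i. m i N) ?e)"
  let ?a = "\<lambda>m i. if i \<le> N then m i (Suc N) else (0::nat)"
  \<comment> \<open>\<open>L\<close> collects the factors of intervals ending before N, which
    merging does not touch; \<open>T\<close> is the summand of \<open>sum_cuts\<close>.\<close>
  define L where "L m = (\<Prod>i<Suc N. \<Prod>j\<in>{i..<N}. PP (m i j))" for m :: "nat \<Rightarrow> nat \<Rightarrow> nat"
  define T where "T m a = fps_X ^ (\<Sum>i<Suc N. (m i N - a i) * (?e - (\<Sum>k\<le>i. a k))) *
      (\<Prod>i<Suc N. PP (a i) * PP (m i N - a i)) * PP (?e - (\<Sum>i<Suc N. a i))"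
    for m :: "nat \<Rightarrow> nat \<Rightarrow> nat" and a :: "nat \<Rightarrow> nat"
  have "(\<Sum>m\<in>kostant (Suc N) d. fps_X ^ cdim (Suc N) d m * PPm (Suc N) m)
      = (\<Sum>(m, a)\<in>?S. fps_X ^ cdim N d m * L m * T m a)"
  proof (rule sum.reindex_bij_witness[of _ "\<lambda>(m, a). split_last N ?e m a" "\<lambda>m. (merge_last N m, ?a m)"])
    fix m assume m: "m \<in> kostant (Suc N) d"
    show "(case (merge_last N m, ?a m) of (m, a) \<Rightarrow> split_last N ?e m a) = m"
      using split_merge_last[OF m] by simp
    show "(merge_last N m, ?a m) \<in> ?S"
      using split_merge_last[OF m] merge_last_kostant[OF m] by simp
    have L: "L (merge_last N m) = L m"
      unfolding L_def by (intro prod.cong refl) (auto simp: merge_last_def)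
    have dN: "?e = (\<Sum>i<Suc N. m i (Suc N)) + m (Suc N) (Suc N)"
      using m by (auto simp: kostant_def lessThan_Suc_atMost)
    have T: "T (merge_last N m) (?a m) = fps_X ^ (\<Sum>i<Suc N. m i N * (?e - (\<Sum>k\<le>i. m k (Suc N)))) *
      (\<Prod>i<Suc N. PP (m i (Suc N)) * PP (m i N)) * PP (m (Suc N) (Suc N))"
    proof -
      have "(\<Sum>i<Suc N. ?a m i) = (\<Sum>i<Suc N. m i (Suc N))" by (intro sum.cong) auto
      then have 1: "?e - (\<Sum>i<Suc N. ?a m i) = m (Suc N) (Suc N)" using dN by linarith
      have 2: "(\<Sum>i<Suc N. (merge_last N m i N - ?a m i) * (?e - (\<Sum>k\<le>i. ?a m k)))
          = (\<Sum>i<Suc N. m i N * (?e - (\<Sum>k\<le>i. m k (Suc N))))"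
        by (intro sum.cong refl arg_cong2[where f = "(*)"] arg_cong2[where f = minus]) (auto simp: merge_last_def)
      have 3: "(\<Prod>i<Suc N. PP (?a m i) * PP (merge_last N m i N - ?a m i))
          = (\<Prod>i<Suc N. PP (m i (Suc N)) * PP (m i N))"
        by (intro prod.cong) (auto simp: merge_last_def)
      show ?thesis unfolding T_def 1 2 3 ..
    qed
    show "(case (merge_last N m, ?a m) of (m, a) \<Rightarrow> fps_X ^ cdim N d m * L m * T m a)
       = fps_X ^ cdim (Suc N) d m * PPm (Suc N) m"
      unfolding prod.case T L cdim_Suc[OF m] PPm_Suc L_def[symmetric] power_add by (simp only: ac_simps)
  next
    fix b assume b: "b \<in> ?S"
    then obtain m a where ma: "b = (m, a)" "m \<in> kostant N d" "a \<in> cuts (Suc N) (\<lambda>i. m i N) ?e" by auto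
    show "(case b of (m, a) \<Rightarrow> split_last N ?e m a) \<in> kostant (Suc N) d"
      using split_last_kostant ma by simp
    have "?a (split_last N ?e m a) = a"
      using ma(3) by (auto simp: fun_eq_iff split_last_def cuts_def)
    then show "(merge_last N (case b of (m, a) \<Rightarrow> split_last N ?e m a), ?a (case b of (m, a) \<Rightarrow> split_last N ?e m a)) = b"
      using merge_split_last[OF ma(2,3)] unfolding ma(1) prod.case by simp
  qed
  also have "\<dots> = (\<Sum>m\<in>kostant N d. fps_X ^ cdim N d m * L m * (\<Sum>a\<in>cuts (Suc N) (\<lambda>i. m i N) ?e. T m a))"
    by (subst sum.Sigma[symmetric]) (auto simp: finite_kostant finite_cuts sum_distrib_left)
  also have "\<dots> = (\<Sum>m\<in>kostant N d. fps_X ^ cdim N d m * PPm N m) * PP ?e"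
    unfolding T_def sum_cuts PPm_last L_def sum_distrib_right by (simp only: ac_simps)
  finally show ?case using Suc by simp
qed

section \<open>Splitting off the full interval, with \<open>cdim\<close> in place of the topological
  codimension, and inversion\<close>

definition kostant_sum :: "nat \<Rightarrow> (nat \<Rightarrow> nat) \<Rightarrow> nat \<Rightarrow> rat fps" where
  "kostant_sum N d r = (\<Sum>m\<in>{m \<in> kostant N d. m 0 N = r}. fps_X ^ cdim N d m * PPm N m)"

text \<open>The multiplicity of the full interval is overwritten rather than increased, so that
  \<open>add_full N 0\<close> removes it and serves as the inverse operation.\<close>

definition add_full :: "nat \<Rightarrow> nat \<Rightarrow> (nat \<Rightarrow> nat \<Rightarrow> nat) \<Rightarrow> nat \<Rightarrow> nat \<Rightarrow> nat" where
  "add_full N r m i j = (if i = 0 \<and> j = N then r else m i j)"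

lemma rk_add_full:
  assumes "j \<le> N" "m 0 N = 0"
  shows "rk N (add_full N r m) i j = rk N m i j + r"
proof -
  have *: "rk N m' i j = m' 0 N + (\<Sum>l\<in>{j..<N}. m' 0 l) + (\<Sum>k\<in>{0<..i}. \<Sum>l\<in>{j..N}. m' k l)" for m'
  proof -
    have "{..i} = insert 0 {0<..i}" "{j..N} = insert N {j..<N}" using assms(1) by auto
    then show ?thesis by (simp add: rk_def)
  qed
  have "(\<Sum>l\<in>{j..<N}. add_full N r m 0 l) = (\<Sum>l\<in>{j..<N}. m 0 l)"
    by (intro sum.cong) (auto simp: add_full_def)
  moreover have "(\<Sum>k\<in>{0<..i}. \<Sum>l\<in>{j..N}. add_full N r m k l) = (\<Sum>k\<in>{0<..i}. \<Sum>l\<in>{j..N}. m k l)"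
    by (intro sum.cong) (auto simp: add_full_def)
  ultimately show ?thesis using assms(2) by (simp add: * add_full_def)
qed

lemma kostant_iff:
  "m \<in> kostant N d \<longleftrightarrow> (\<forall>i j. m i j \<noteq> 0 \<longrightarrow> i \<le> j \<and> j \<le> N) \<and> (\<forall>k\<le>N. d k = rk N m k k)"
  by (simp add: kostant_def rk_def)

lemma rk_ge_full:
  assumes "j \<le> N"
  shows "m 0 N \<le> rk N m i j"
proof -
  have "m 0 N \<le> (\<Sum>l\<in>{j..N}. m 0 l)" by (rule member_le_sum) (use assms in auto)
  also have "\<dots> \<le> (\<Sum>k\<le>i. \<Sum>l\<in>{j..N}. m k l)"
    by (rule member_le_sum[of 0 "{..i}" "\<lambda>k. \<Sum>l\<in>{j..N}. m k l"]) auto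
  finally show ?thesis by (simp add: rk_def)
qed

lemma PPm_add_full:
  assumes "m 0 N = 0"
  shows "PPm N (add_full N r m) = PP r * PPm N m"
proof -
  have *: "PPm N m' = PP (m' 0 N) * (\<Prod>l<N. PP (m' 0 l)) * (\<Prod>k\<in>{0<..N}. \<Prod>l\<in>{k..N}. PP (m' k l))" for m'
  proof -
    have "{..N} = insert 0 {0<..N}" "{0..N} = insert N {..<N}" by auto
    then show ?thesis by (simp add: PPm_def)
  qed
  have "(\<Prod>l<N. PP (add_full N r m 0 l)) = (\<Prod>l<N. PP (m 0 l))"
    by (intro prod.cong) (auto simp: add_full_def)
  moreover have "(\<Prod>k\<in>{0<..N}. \<Prod>l\<in>{k..N}. PP (add_full N r m k l)) = (\<Prod>k\<in>{0<..N}. \<Prod>l\<in>{k..N}. PP (m k l))"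
    by (intro prod.cong) (auto simp: add_full_def)
  ultimately show ?thesis using assms by (simp add: * add_full_def ac_simps)
qed

text \<open>Full intervals count in every rank and in every dimension, so the differences in
  \<open>cdim\<close> keep their values; the entry \<open>m 0 N\<close> is itself never a factor
  there, since n < N.\<close>

lemma cdim_add_full:
  assumes "m 0 N = 0"
  shows "cdim N d (add_full N r m) = cdim N (\<lambda>k. d k - r) m"
  unfolding cdim_def
  by (intro sum.cong refl arg_cong2[where f = "(*)"])
     (use assms in \<open>auto simp: rk_add_full\<close>, auto simp: add_full_def)

lemma kostant_sum_shift:
  assumes r: "\<And>k. k \<le> N \<Longrightarrow> r \<le> d k"
  shows "kostant_sum N d r = PP r * kostant_sum N (\<lambda>k. d k - r) 0"
proof -
  have "(\<Sum>m\<in>{m \<in> kostant N d. m 0 N = r}. fps_X ^ cdim N d m * PPm N m)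
      = (\<Sum>m\<in>{m \<in> kostant N (\<lambda>k. d k - r). m 0 N = 0}. PP r * (fps_X ^ cdim N (\<lambda>k. d k - r) m * PPm N m))"
  proof (rule sum.reindex_bij_witness[of _ "add_full N r" "add_full N 0"])
    fix m assume "m \<in> {m \<in> kostant N d. m 0 N = r}"
    then have m: "m \<in> kostant N d" "m 0 N = r" by auto
    let ?m = "add_full N 0 m"
    show eq: "add_full N r ?m = m"
      using m by (auto simp: add_full_def fun_eq_iff)
    have 0: "?m 0 N = 0" by (simp add: add_full_def)
    have "rk N ?m k k = d k - r" if "k \<le> N" for k
      using rk_add_full[of k N ?m r k, OF that 0] kostant_rk[OF m(1) that] unfolding eq by simp
    moreover have "?m i j \<noteq> 0 \<longrightarrow> i \<le> j \<and> j \<le> N" for i j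
      using m(1) by (simp add: add_full_def kostant_iff)
    ultimately show "?m \<in> {m \<in> kostant N (\<lambda>k. d k - r). m 0 N = 0}"
      using 0 unfolding kostant_iff by auto
    show "PP r * (fps_X ^ cdim N (\<lambda>k. d k - r) ?m * PPm N ?m) = fps_X ^ cdim N d m * PPm N m"
      using cdim_add_full[of ?m N d r, OF 0] PPm_add_full[of ?m N r, OF 0] unfolding eq by (simp add: ac_simps)
  next
    fix m assume "m \<in> {m \<in> kostant N (\<lambda>k. d k - r). m 0 N = 0}"
    then have m: "m \<in> kostant N (\<lambda>k. d k - r)" "m 0 N = 0" by auto
    show "add_full N 0 (add_full N r m) = m"
      using m by (auto simp: add_full_def fun_eq_iff)
    have "rk N (add_full N r m) k k = d k" if "k \<le> N" for k
      using rk_add_full[of k N m r k, OF that m(2)] kostant_rk[OF m(1) that] r[OF that] by simp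
    moreover have "add_full N r m i j \<noteq> 0 \<longrightarrow> i \<le> j \<and> j \<le> N" for i j
      using m(1) by (simp add: add_full_def kostant_iff)
    ultimately show "add_full N r m \<in> {m \<in> kostant N d. m 0 N = r}"
      unfolding kostant_iff by (auto simp: add_full_def)
  qed
  then show ?thesis by (simp add: kostant_sum_def sum_distrib_left)
qed

lemma mind_le: "k \<le> N \<Longrightarrow> mind N d \<le> d k"
  by (simp add: mind_def)

lemma mind_diff: "mind N (\<lambda>k. d k - t) = mind N d - t"
proof -
  have "mono (\<lambda>x::nat. x - t)" by (auto simp: mono_def)
  then have "Min (d ` {..N}) - t = Min ((\<lambda>x. x - t) ` d ` {..N})"
    by (rule mono_Min_commute) auto
  then show ?thesis by (simp add: mind_def image_image)
qed

text \<open>The full intervals pass through every space, so \<open>m 0 N\<close> is at most the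
  smallest dimension and grouping the partitions by this entry loses none.\<close>

lemma sum_kostant_sum: "(\<Sum>r\<le>mind N d. kostant_sum N d r) = (\<Prod>k\<le>N. PP (d k))"
proof -
  have "m 0 N \<le> mind N d" if "m \<in> kostant N d" for m
  proof -
    have "m 0 N \<le> d k" if "k \<le> N" for k
      using rk_ge_full[OF that, of m k] kostant_rk[OF \<open>m \<in> kostant N d\<close> that] by simp
    then show ?thesis by (simp add: mind_def)
  qed
  then have "(\<Sum>r\<le>mind N d. kostant_sum N d r) = (\<Sum>m\<in>kostant N d. fps_X ^ cdim N d m * PPm N m)"
    unfolding kostant_sum_def by (intro sum.group finite_kostant finite_atMost) auto
  then show ?thesis by (simp add: sum_kostant)
qed

text \<open>With \<open>Z t\<close> the sum over partitions of \<open>d - r - t\<close> without full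
  intervals, each product over k is the sum of \<open>PP t * Z (s + t)\<close>. Collecting by n = s
  + t, the coefficient of \<open>Z n\<close> is the Euler sum, which is 1 for n = 0 and 0 otherwise.
  What remains is \<open>Z 0\<close>, and \<open>PP r * Z 0\<close> is the sum in question by the
  shift.\<close>

lemma kostant_sum_formula:
  assumes r: "r \<le> mind N d"
  shows "kostant_sum N d r = PP r * (\<Sum>s\<in>{0..mind N d - r}.
     (-1) ^ s * fps_X ^ (s choose 2) * PP s * (\<Prod>k\<le>N. PP (d k - r - s)))"
proof -
  define M where "M = mind N d - r"
  define Z where "Z t = kostant_sum N (\<lambda>k. d k - r - t) 0" for t
  define c :: "nat \<Rightarrow> rat fps" where "c s = (-1) ^ s * fps_X ^ (s choose 2) * PP s" for s
  have prd: "(\<Prod>k\<le>N. PP (d k - r - s)) = (\<Sum>t\<le>M - s. PP t * Z (s + t))" if "s \<le> M" for s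
  proof -
    have mi: "mind N (\<lambda>k. d k - r - s) = M - s"
      unfolding mind_diff M_def ..
    have "kostant_sum N (\<lambda>k. d k - r - s) t = PP t * Z (s + t)" if "t \<le> M - s" for t
    proof -
      have "t \<le> d k - r - s" if "k \<le> N" for k
        using mind_le[OF that, of "\<lambda>k. d k - r - s"] \<open>t \<le> M - s\<close> unfolding mi by linarith
      then show ?thesis
        by (subst kostant_sum_shift) (simp_all add: Z_def add.assoc)
    qed
    then show ?thesis
      unfolding sum_kostant_sum[symmetric] mi by (intro sum.cong) auto
  qed
  have "(\<Sum>s\<le>M. c s * (\<Prod>k\<le>N. PP (d k - r - s))) = (\<Sum>s\<le>M. \<Sum>t\<le>M - s. c s * PP t * Z (s + t))"
    by (intro sum.cong refl) (simp only: atMost_iff prd sum_distrib_left mult.assoc)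
  also have "\<dots> = (\<Sum>(s, t)\<in>Sigma {..M} (\<lambda>s. {..M - s}). c s * PP t * Z (s + t))"
    by (rule sum.Sigma) auto
  also have "\<dots> = (\<Sum>(n, s)\<in>Sigma {..M} (\<lambda>n. {..n}). c s * PP (n - s) * Z n)"
    by (rule sum.reindex_bij_witness[of _ "\<lambda>(n, s). (s, n - s)" "\<lambda>(s, t). (s + t, s)"]) auto
  also have "\<dots> = (\<Sum>n\<le>M. (\<Sum>s\<le>n. c s * PP (n - s)) * Z n)"
    by (subst sum.Sigma[symmetric]) (auto simp: sum_distrib_right)
  also have "\<dots> = (\<Sum>n\<le>M. (if n = 0 then 1 else 0) * Z n)"
    unfolding c_def euler_inversion ..
  also have "\<dots> = Z 0"
    by (simp add: if_distrib[of "\<lambda>x. x * _"] cong: if_cong)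
  finally have "(\<Sum>s\<le>M. c s * (\<Prod>k\<le>N. PP (d k - r - s))) = Z 0" .
  moreover have "kostant_sum N d r = PP r * Z 0"
    using kostant_sum_shift[of N r d] mind_le[of _ N d] r by (auto simp: Z_def intro: order_trans)
  ultimately show ?thesis by (simp add: c_def M_def atLeast0AtMost)
qed

section \<open>Uniqueness of the topological dimension\<close>

lemma Euclidean_space_eq_top_of_set: "Euclidean_space n = top_of_set {x. \<forall>i\<ge>n. x i = 0}"
  by (simp add: Euclidean_space_def euclidean_product_topology)

text \<open>If k < l, then k-space is a coordinate subspace of l-space and invariance of domain
  makes the image of f open in l-space. But all its points have k-th coordinate 0, so the line
  \<open>h\<close> in that direction through an image point meets it only at 0, and a single point
  would be open in the reals.\<close>

lemma Euclidean_space_inj_dim_le: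
  assumes U: "openin (Euclidean_space l) U" "U \<noteq> {}"
    and f: "continuous_map (subtopology (Euclidean_space l) U) (Euclidean_space k) f" "inj_on f U"
  shows "l \<le> k"
proof (rule ccontr)
  assume "\<not> l \<le> k"
  then have kl: "k < l" by simp
  have "Euclidean_space k = subtopology (Euclidean_space l) (topspace (Euclidean_space k))"
    using kl by (auto simp: Euclidean_space_eq_top_of_set subtopology_subtopology topspace_Euclidean_space
        intro!: arg_cong[where f = top_of_set])
  then have "continuous_map (subtopology (Euclidean_space l) U) (Euclidean_space l) f"
    using f(1) by (metis continuous_map_in_subtopology)
  then have op: "openin (Euclidean_space l) (f ` U)"
    using U(1) f(2) by (intro invariance_of_domain_Euclidean_space)
  have sub: "f ` U \<subseteq> topspace (Euclidean_space k)"
    using f(1) U(1) by (metis continuous_map_image_subset_topspace openin_subset topspace_subtopology_subset)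
  obtain y where y: "y \<in> f ` U" using U(2) by blast
  define h where "h t = y(k := t)" for t :: real
  have y0: "y i = 0" if "i \<ge> k" for i using y sub that by (auto simp: topspace_Euclidean_space)
  have "continuous_on UNIV h"
    unfolding h_def
  proof (rule continuous_on_coordinatewise_then_product)
    show "continuous_on UNIV (\<lambda>t. (y(k := t)) i)" for i by (cases "i = k") auto
  qed
  moreover have "h \<in> UNIV \<rightarrow> {x. \<forall>i\<ge>l. x i = 0}"
    using kl y0 by (auto simp: h_def)
  ultimately have "openin (top_of_set UNIV) (UNIV \<inter> h -` (f ` U))"
    using op unfolding Euclidean_space_eq_top_of_set by (rule continuous_openin_preimage)
  then have "open (h -` (f ` U))" by simp
  moreover have "h -` (f ` U) \<subseteq> {0}"
  proof
    fix t assume "t \<in> h -` (f ` U)"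
    then have "h t \<in> topspace (Euclidean_space k)" using sub by blast
    then have "h t k = 0" by (auto simp: topspace_Euclidean_space)
    then show "t \<in> {0}" by (simp add: h_def)
  qed
  moreover have "0 \<in> h -` (f ` U)"
  proof -
    have "h 0 = y" using y0 by (auto simp: h_def)
    then show ?thesis using y by simp
  qed
  ultimately have "open {0 :: real}" by (metis subset_singletonD empty_iff)
  then show False by (simp add: not_open_singleton)
qed

text \<open>Two charts around a common point overlap in a nonempty open set; its image
  \<open>W\<close> in k-space is mapped injectively into l-space by the transition map.\<close>

lemma locally_euclidean_dim_le:
  assumes k: "locally_euclidean_dim X k" and l: "locally_euclidean_dim X l" and ne: "topspace X \<noteq> {}"
  shows "k \<le> l"
proof -
  obtain x where x: "x \<in> topspace X" using ne by blast
  obtain U V f g where U: "openin X U" "x \<in> U" and V: "openin (Euclidean_space k) V"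
    and fg: "homeomorphic_maps (subtopology X U) (subtopology (Euclidean_space k) V) f g"
    using bspec[OF k[unfolded locally_euclidean_dim_def homeomorphic_space_def] x] by (elim exE conjE)
  obtain U' V' f' g' where U': "openin X U'" "x \<in> U'" and V': "openin (Euclidean_space l) V'"
    and fg': "homeomorphic_maps (subtopology X U') (subtopology (Euclidean_space l) V') f' g'"
    using bspec[OF l[unfolded locally_euclidean_dim_def homeomorphic_space_def] x] by (elim exE conjE)
  have tU: "topspace (subtopology X A) = A" if "openin X A" for A
    using openin_subset[OF that] by auto
  define W where "W = f ` (U \<inter> U')"
  have "openin (subtopology X U) (U \<inter> U')"
    using U(1) U'(1) by (simp add: openin_open_subtopology openin_Int)
  moreover have "open_map (subtopology X U) (subtopology (Euclidean_space k) V) f"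
    using fg by (simp add: homeomorphic_maps_map homeomorphic_imp_open_map)
  ultimately have "openin (subtopology (Euclidean_space k) V) W"
    unfolding W_def open_map_def by blast
  then have W: "openin (Euclidean_space k) W"
    using V openin_trans_full by blast
  have WV: "W \<subseteq> V" using \<open>openin (subtopology (Euclidean_space k) V) W\<close> openin_imp_subset by blast
  have gf: "g (f z) = z" if "z \<in> U" for z
    using fg that tU[OF U(1)] by (auto simp: homeomorphic_maps_def)
  have gf': "g' (f' z) = z" if "z \<in> U'" for z
    using fg' that tU[OF U'(1)] by (auto simp: homeomorphic_maps_def)
  have gW: "g ` W \<subseteq> U'" unfolding W_def using gf by auto
  have "continuous_map (subtopology (Euclidean_space k) V) (subtopology X U) g"
    using fg by (simp add: homeomorphic_maps_def)
  then have "continuous_map (subtopology (Euclidean_space k) W) X g"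
    using WV by (blast intro: continuous_map_from_subtopology_mono continuous_map_into_fulltopology)
  then have "continuous_map (subtopology (Euclidean_space k) W) (subtopology X U') g"
    using gW by (auto simp: continuous_map_in_subtopology)
  moreover have "continuous_map (subtopology X U') (Euclidean_space l) f'"
    using fg' by (auto simp: homeomorphic_maps_def dest: continuous_map_into_fulltopology)
  ultimately have "continuous_map (subtopology (Euclidean_space k) W) (Euclidean_space l) (f' \<circ> g)"
    by (rule continuous_map_compose)
  moreover have "inj_on (f' \<circ> g) W"
    unfolding W_def by (rule inj_on_inverseI[where g = "f \<circ> g'"]) (auto simp: gf gf')
  moreover have "W \<noteq> {}" using U U' by (auto simp: W_def)
  ultimately show ?thesis using Euclidean_space_inj_dim_le W by blast
qed

text \<open>Nonemptiness matters: the empty space is locally Euclidean of every dimension, and the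
  description would then denote no particular number.\<close>

lemma the_locally_euclidean_dim:
  assumes "locally_euclidean_dim X k" "topspace X \<noteq> {}"
  shows "(THE k. locally_euclidean_dim X k) = k"
proof (rule the_equality)
  fix l assume "locally_euclidean_dim X l"
  then show "l = k" using assms locally_euclidean_dim_le[of X l k] locally_euclidean_dim_le[of X k l] by simp
qed (rule assms(1))

lemma locally_euclidean_dimI:
  assumes "\<And>x. x \<in> S \<Longrightarrow> \<exists>U V f g. openin (top_of_set S) U \<and> x \<in> U \<and>
      openin (top_of_set {y :: nat \<Rightarrow> real. \<forall>i\<ge>k. y i = 0}) V \<and> homeomorphism U V f g"
  shows "locally_euclidean_dim (top_of_set S) k"
  unfolding locally_euclidean_dim_def
proof
  fix x assume "x \<in> topspace (top_of_set S)"
  then obtain U V f g where U: "openin (top_of_set S) U" "x \<in> U"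
    and V: "openin (top_of_set {y :: nat \<Rightarrow> real. \<forall>i\<ge>k. y i = 0}) V" and h: "homeomorphism U V f g"
    using assms[of x] unfolding topspace_euclidean_subtopology by blast
  have "subtopology (top_of_set S) U = top_of_set U"
    using openin_imp_subset[OF U(1)] by (simp add: subtopology_subtopology inf.absorb2)
  moreover have "subtopology (Euclidean_space k) V = top_of_set V"
    using openin_imp_subset[OF V] by (simp add: Euclidean_space_eq_top_of_set subtopology_subtopology inf.absorb2)
  ultimately have "subtopology (top_of_set S) U homeomorphic_space subtopology (Euclidean_space k) V"
    using h by (auto simp: homeomorphic_def)
  then show "\<exists>U V. openin (top_of_set S) U \<and> x \<in> U \<and> openin (Euclidean_space k) V \<and>
      subtopology (top_of_set S) U homeomorphic_space subtopology (Euclidean_space k) V"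
    using U V unfolding Euclidean_space_eq_top_of_set by blast
qed

section \<open>Matrices as functions\<close>

definition tomat :: "nat \<Rightarrow> (nat \<Rightarrow> nat \<Rightarrow> complex) \<Rightarrow> complex mat" where
  "tomat n M = Matrix.mat n n (\<lambda>(i, j). M i j)"

definition mdet :: "nat \<Rightarrow> (nat \<Rightarrow> nat \<Rightarrow> complex) \<Rightarrow> complex" where
  "mdet n M = Determinant.det (tomat n M)"

text \<open>The adjugate formula exhibits each entry as a quotient of polynomials in the entries of
  \<open>M\<close>, from which continuity is read off.\<close>

definition minv :: "nat \<Rightarrow> (nat \<Rightarrow> nat \<Rightarrow> complex) \<Rightarrow> nat \<Rightarrow> nat \<Rightarrow> complex" where
  "minv n M i j = (if i < n \<and> j < n then adj_mat (tomat n M) $$ (i, j) / mdet n M else 0)"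

lemma tomat_carrier [simp]: "tomat n M \<in> carrier_mat n n"
  by (simp add: tomat_def)

lemma tomat_index [simp]: "i < n \<Longrightarrow> j < n \<Longrightarrow> tomat n M $$ (i, j) = M i j"
  by (simp add: tomat_def)

lemma index_mult_sum:
  assumes "A \<in> carrier_mat n n" "B \<in> carrier_mat n n" "i < n" "j < n"
  shows "(A * B) $$ (i, j) = (\<Sum>t<n. A $$ (i, t) * B $$ (t, j))"
  using assms by (auto simp: scalar_prod_def lessThan_atLeast0 intro!: sum.cong)

lemma minv_right:
  assumes "mdet n M \<noteq> 0" "i < n" "j < n"
  shows "(\<Sum>t<n. M i t * minv n M t j) = (if i = j then 1 else 0)"
proof -
  note adj = adj_mat[OF tomat_carrier[of n M]]
  have "(\<Sum>t<n. M i t * minv n M t j) = (tomat n M * adj_mat (tomat n M)) $$ (i, j) / mdet n M"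
    unfolding index_mult_sum[OF tomat_carrier adj(1) assms(2,3)] sum_divide_distrib
    using assms by (intro sum.cong) (auto simp: minv_def)
  then show ?thesis unfolding adj(2) using assms by (simp add: mdet_def)
qed

lemma minv_left:
  assumes "mdet n M \<noteq> 0" "i < n" "j < n"
  shows "(\<Sum>t<n. minv n M i t * M t j) = (if i = j then 1 else 0)"
proof -
  note adj = adj_mat[OF tomat_carrier[of n M]]
  have "(\<Sum>t<n. minv n M i t * M t j) = (adj_mat (tomat n M) * tomat n M) $$ (i, j) / mdet n M"
    unfolding index_mult_sum[OF adj(1) tomat_carrier assms(2,3)] sum_divide_distrib
    using assms by (intro sum.cong) (auto simp: minv_def)
  then show ?thesis unfolding adj(3) using assms by (simp add: mdet_def)
qed

lemma minv_expand:
  assumes "mdet n E \<noteq> 0" "a < n"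
  shows "(\<Sum>s<n. E a s * (\<Sum>t<n. minv n E s t * v t)) = v a"
proof -
  have "(\<Sum>s<n. E a s * (\<Sum>t<n. minv n E s t * v t)) = (\<Sum>s<n. \<Sum>t<n. E a s * minv n E s t * v t)"
    by (simp add: sum_distrib_left ac_simps)
  also have "\<dots> = (\<Sum>t<n. (\<Sum>s<n. E a s * minv n E s t) * v t)"
    by (subst sum.swap) (simp add: sum_distrib_right)
  also have "\<dots> = (\<Sum>t<n. if a = t then v t else 0)"
    using assms by (intro sum.cong refl) (simp add: minv_right)
  also have "\<dots> = v a" using assms by simp
  finally show ?thesis .
qed

lemma mdet_nonzeroI:
  assumes "\<And>i j. i < n \<Longrightarrow> j < n \<Longrightarrow> (\<Sum>t<n. M i t * L t j) = (if i = j then 1 else 0)"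
  shows "mdet n M \<noteq> 0"
proof -
  have "tomat n M * tomat n L = 1\<^sub>m n"
  proof (rule eq_matI)
    fix i j assume "i < dim_row (1\<^sub>m n :: complex mat)" "j < dim_col (1\<^sub>m n :: complex mat)"
    then show "(tomat n M * tomat n L) $$ (i, j) = 1\<^sub>m n $$ (i, j)"
      using index_mult_sum[OF tomat_carrier tomat_carrier, of i n j M L] assms[of i j] by simp
  qed (auto simp: tomat_def)
  then have "Determinant.det (tomat n M) * Determinant.det (tomat n L) = 1"
    by (simp flip: det_mult[OF tomat_carrier tomat_carrier])
  then show ?thesis by (auto simp: mdet_def)
qed

lemma continuous_on_mdet:
  assumes "\<And>i j. i < n \<Longrightarrow> j < n \<Longrightarrow> continuous_on S (\<lambda>x. M x i j)"
  shows "continuous_on S (\<lambda>x. mdet n (M x))"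
proof -
  have eq: "mdet n (M x) = (\<Sum>p\<in>{p. p permutes {0..<n}}. signof p * (\<Prod>i\<in>{0..<n}. M x i (p i)))" for x
    unfolding mdet_def det_def'[OF tomat_carrier]
  proof (intro sum.cong refl arg_cong2[where f = "(*)"] prod.cong)
    fix p i assume "p \<in> {p. p permutes {0..<n}}" "i \<in> {0..<n}"
    then have "i < n" "p i < n" by (auto simp: permutes_in_image[of p "{0..<n}" i, simplified])
    then show "tomat n (M x) $$ (i, p i) = M x i (p i)" by simp
  qed
  show ?thesis unfolding eq
  proof (intro continuous_intros)
    fix p i assume "p \<in> {p. p permutes {0..<n}}" "i \<in> {0..<n}"
    then show "continuous_on S (\<lambda>x. M x i (p i))"
      by (intro assms) (auto simp: permutes_in_image[of p "{0..<n}" i, simplified])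
  qed
qed

lemma minv_eq_cofactor:
  assumes "i < n" "j < n"
  shows "minv n M i j = (-1) ^ (j + i) *
    mdet (n - 1) (\<lambda>a b. M (if a < j then a else Suc a) (if b < i then b else Suc b)) / mdet n M"
proof -
  have "mat_delete (tomat n M) j i = tomat (n - 1) (\<lambda>a b. M (if a < j then a else Suc a) (if b < i then b else Suc b))"
    using assms by (intro eq_matI) (auto simp: mat_delete_def tomat_def)
  then show ?thesis
    using assms by (simp add: minv_def adj_mat_def cofactor_def mdet_def tomat_def)
qed

lemma continuous_on_minv:
  assumes M: "\<And>i j. i < n \<Longrightarrow> j < n \<Longrightarrow> continuous_on S (\<lambda>x. M x i j)"
    and nz: "\<And>x. x \<in> S \<Longrightarrow> mdet n (M x) \<noteq> 0"
  shows "continuous_on S (\<lambda>x. minv n (M x) i j)"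
proof (cases "i < n \<and> j < n")
  case True
  then have ij: "i < n" "j < n" by auto
  have "continuous_on S (\<lambda>x. mdet (n - 1) (\<lambda>a b. M x (if a < j then a else Suc a) (if b < i then b else Suc b)))"
    by (rule continuous_on_mdet) (use ij in \<open>auto intro!: M\<close>)
  then show ?thesis
    unfolding minv_eq_cofactor[OF ij] using nz continuous_on_mdet[OF M]
    by (intro continuous_intros) auto
next
  case False
  then have "minv n (M x) i j = 0" for x by (auto simp: minv_def)
  then show ?thesis by (simp only: continuous_on_const)
qed

section \<open>Spans, dimensions and pivots of families of columns\<close>

interpretation cv: vector_space "\<lambda>(c::complex) (v::nat \<Rightarrow> complex). \<lambda>x. c * v x"
  by unfold_locales (auto simp: fun_eq_iff algebra_simps)

definition mcol :: "(nat \<Rightarrow> nat \<Rightarrow> complex) \<Rightarrow> nat \<Rightarrow> nat \<Rightarrow> complex" where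
  "mcol M b = (\<lambda>a. M a b)"

lemma mrank_eq: "mrank M n = cv.dim (mcol M ` {..<n})"
  by (simp add: mrank_def mcol_def)

text \<open>The coefficients belong to positions and not to vectors, so the family may contain
  repetitions.\<close>

lemma span_family_iff:
  fixes w :: "nat \<Rightarrow> nat \<Rightarrow> complex"
  shows "x \<in> cv.span (w ` {..<k}) \<longleftrightarrow> (\<exists>c. x = (\<lambda>a. \<Sum>t<k. c t * w t a))"
proof (induction k arbitrary: x)
  case 0
  then show ?case by (auto simp: fun_eq_iff)
next
  case (Suc k)
  have "x \<in> cv.span (w ` {..<Suc k}) \<longleftrightarrow> (\<exists>b. x - (\<lambda>a. b * w k a) \<in> cv.span (w ` {..<k}))"
    by (simp add: lessThan_Suc cv.span_insert)
  also have "\<dots> \<longleftrightarrow> (\<exists>b c. x - (\<lambda>a. b * w k a) = (\<lambda>a. \<Sum>t<k. c t * w t a))"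
    unfolding Suc ..
  also have "\<dots> \<longleftrightarrow> (\<exists>c. x = (\<lambda>a. \<Sum>t<Suc k. c t * w t a))"
  proof safe
    fix b c assume "x - (\<lambda>a. b * w k a) = (\<lambda>a. \<Sum>t<k. c t * w t a)"
    then have "x a = (\<Sum>t<Suc k. (c(k := b)) t * w t a)" for a
      by (simp add: fun_eq_iff algebra_simps)
    then show "\<exists>c. x = (\<lambda>a. \<Sum>t<Suc k. c t * w t a)" by blast
  next
    fix c
    have "(\<lambda>a. \<Sum>t<Suc k. c t * w t a) - (\<lambda>a. c k * w k a) = (\<lambda>a. \<Sum>t<k. c t * w t a)"
      by (simp add: fun_eq_iff)
    then show "\<exists>b ca. (\<lambda>a. \<Sum>t<Suc k. c t * w t a) - (\<lambda>a. b * w k a) = (\<lambda>a. \<Sum>t<k. ca t * w t a)"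
      by blast
  qed
  finally show ?case .
qed

text \<open>The positions kept by a greedy selection from left to right, as the pivot columns in
  Gaussian elimination.\<close>

definition pivots :: "(nat \<Rightarrow> nat \<Rightarrow> complex) \<Rightarrow> nat set" where
  "pivots w = {q. w q \<notin> cv.span (w ` {..<q})}"

text \<open>A position that is not a pivot does not enlarge the span, and a pivot preserves
  independence. One set of positions thus yields a basis for the span of every initial segment at
  once, which is what a frame adapted to a flag of images needs.\<close>

lemma pivots_basis:
  fixes w :: "nat \<Rightarrow> nat \<Rightarrow> complex"
  defines "G \<equiv> \<lambda>k. pivots w \<inter> {..<k}"
  shows "cv.span (w ` G k) = cv.span (w ` {..<k}) \<and> cv.independent (w ` G k) \<and> card (w ` G k) = card (G k)"
proof (induction k)
  case 0
  then show ?case by (simp add: G_def cv.independent_empty)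
next
  case (Suc k)
  then have IH: "cv.span (w ` G k) = cv.span (w ` {..<k})" "cv.independent (w ` G k)" "card (w ` G k) = card (G k)"
    by auto
  show ?case
  proof (cases "k \<in> pivots w")
    case True
    then have G: "G (Suc k) = insert k (G k)" by (auto simp: G_def)
    have nin: "w k \<notin> cv.span (w ` G k)" using True IH(1) by (simp add: pivots_def)
    then have "w k \<notin> w ` G k" using cv.span_base by blast
    moreover have "finite (G k)" "k \<notin> G k" by (auto simp: G_def)
    ultimately show ?thesis
      using IH nin by (simp add: G lessThan_Suc cv.span_insert cv.independent_insert)
  next
    case False
    then have G: "G (Suc k) = G k" by (auto simp: G_def less_Suc_eq)
    have "w k \<in> cv.span (w ` {..<k})" using False by (simp add: pivots_def)
    then show ?thesis using IH by (simp add: G lessThan_Suc cv.span_redundant)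
  qed
qed

lemma card_pivots: "card (pivots w \<inter> {..<k}) = cv.dim (w ` {..<k})"
  using pivots_basis[of w k] cv.dim_eq_card by metis

lemma dim_family:
  fixes w :: "nat \<Rightarrow> nat \<Rightarrow> complex"
  assumes "\<And>t. t < k \<Longrightarrow> w t \<notin> cv.span (w ` {..<t})"
  shows "cv.dim (w ` {..<k}) = k"
proof -
  have "pivots w \<inter> {..<k} = {..<k}" using assms by (auto simp: pivots_def)
  then show ?thesis using card_pivots[of w k] by simp
qed

text \<open>Row t of the inverse matrix takes the value 1 on column t and 0 on the earlier columns,
  so a linear relation would give 1 = 0.\<close>

lemma mcol_notin_span:
  assumes "mdet n M \<noteq> 0" "t < n"
  shows "mcol M t \<notin> cv.span (mcol M ` {..<t})"
proof
  assume "mcol M t \<in> cv.span (mcol M ` {..<t})"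
  then obtain c where c: "\<And>a. M a t = (\<Sum>s<t. c s * M a s)"
    unfolding span_family_iff mcol_def by metis
  have "1 = (\<Sum>a<n. minv n M t a * M a t)"
    using minv_left[OF assms(1) assms(2) assms(2)] by simp
  also have "\<dots> = (\<Sum>a<n. \<Sum>s<t. minv n M t a * (c s * M a s))"
    by (intro sum.cong refl) (subst c, simp add: sum_distrib_left)
  also have "\<dots> = (\<Sum>s<t. \<Sum>a<n. minv n M t a * (c s * M a s))" by (rule sum.swap)
  also have "\<dots> = (\<Sum>s<t. c s * (\<Sum>a<n. minv n M t a * M a s))"
    by (simp add: sum_distrib_left ac_simps)
  also have "\<dots> = 0"
    using assms by (intro sum.neutral) (auto simp: minv_left)
  finally show False by simp
qed

lemma dim_mcol:
  assumes "mdet n M \<noteq> 0" "k \<le> n"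
  shows "cv.dim (mcol M ` {..<k}) = k"
  by (rule dim_family, rule mcol_notin_span[OF assms(1)]) (use assms in auto)

definition mat_vec :: "(nat \<Rightarrow> nat \<Rightarrow> complex) \<Rightarrow> nat \<Rightarrow> (nat \<Rightarrow> complex) \<Rightarrow> nat \<Rightarrow> complex" where
  "mat_vec A n v = (\<lambda>a. \<Sum>t<n. A a t * v t)"

lemma mcol_mmult: "mcol (mmult M P n) b = mat_vec M n (mcol P b)"
  by (simp add: mcol_def mmult_def mat_vec_def)

lemma mat_vec_span:
  assumes "v \<in> cv.span S"
  shows "mat_vec A n v \<in> cv.span (mat_vec A n ` S)"
  using assms
proof (induction rule: cv.span_induct_alt)
  case base
  show ?case using cv.span_zero[of "mat_vec A n ` S"] by (simp add: mat_vec_def zero_fun_def)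
next
  case (step c x y)
  have *: "mat_vec A n ((\<lambda>a. c * x a) + y) = (\<lambda>a. c * mat_vec A n x a) + mat_vec A n y"
    by (simp add: mat_vec_def fun_eq_iff algebra_simps sum.distrib sum_distrib_left)
  show ?case unfolding * using step by (intro cv.span_add cv.span_scale) (auto intro: cv.span_base)
qed

lemma span_mat_vec_image:
  assumes "cv.span S = cv.span T"
  shows "cv.span (mat_vec A n ` S) = cv.span (mat_vec A n ` T)"
proof -
  have "mat_vec A n ` S \<subseteq> cv.span (mat_vec A n ` T)" if "cv.span S = cv.span T" for S T
    using that mat_vec_span cv.span_base by blast
  then show ?thesis using assms cv.span_eq by metis
qed

text \<open>A vector of \<open>T\<close> outside the span of \<open>S\<close> could be added to
  \<open>S\<close>, giving an independent set larger than a basis of the span of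
  \<open>T\<close>.\<close>

lemma span_eq_of_dim:
  assumes S: "cv.independent S" "S \<subseteq> cv.span T" and T: "finite T" "cv.dim T \<le> card S"
  shows "cv.span S = cv.span T"
proof -
  obtain B where B: "B \<subseteq> T" "cv.independent B" "T \<subseteq> cv.span B" "card B = cv.dim T"
    using cv.basis_exists by blast
  have finB: "finite B" using B(1) T(1) finite_subset by blast
  have TB: "cv.span T \<subseteq> cv.span B" using B(3) cv.span_minimal cv.subspace_span by blast
  have "t \<in> cv.span S" if t: "t \<in> T" for t
  proof (rule ccontr)
    assume n: "t \<notin> cv.span S"
    have S': "finite S" using cv.independent_span_bound[OF finB S(1)] S(2) TB by blast
    have "cv.independent (insert t S)" using n S(1) by (simp add: cv.independent_insert)
    moreover have "insert t S \<subseteq> cv.span B" using t S(2) TB B(3) by blast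
    ultimately have "card (insert t S) \<le> card B" using cv.independent_span_bound[OF finB] by blast
    moreover have "t \<notin> S" using n cv.span_base by blast
    ultimately show False using S' B(4) T(2) by simp
  qed
  then have "cv.span T \<subseteq> cv.span S" by (intro cv.span_minimal cv.subspace_span) blast
  moreover have "cv.span S \<subseteq> cv.span T" using S(2) by (intro cv.span_minimal cv.subspace_span)
  ultimately show ?thesis by blast
qed

lemma span_mcol_eq_of_dim:
  assumes "mdet n M \<noteq> 0" "k \<le> n" "mcol M ` {..<k} \<subseteq> cv.span T" "finite T" "cv.dim T = k"
  shows "cv.span (mcol M ` {..<k}) = cv.span T"
proof -
  have "pivots (mcol M) \<inter> {..<k} = {..<k}"
    using assms(2) mcol_notin_span[OF assms(1)] by (auto simp: pivots_def)
  then have "cv.independent (mcol M ` {..<k})" "card (mcol M ` {..<k}) = k"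
    using pivots_basis[of "mcol M" k] by auto
  then show ?thesis using assms by (intro span_eq_of_dim) auto
qed

lemma mdet_idmat: "mdet n (idmat n) \<noteq> 0"
proof (rule mdet_nonzeroI[of _ _ "idmat n"])
  fix i j assume "i < n" "j < n"
  moreover have "(\<Sum>t<n. idmat n i t * idmat n t j) = (\<Sum>t<n. if t = i then idmat n i j else 0)"
    by (intro sum.cong) (auto simp: idmat_def)
  ultimately show "(\<Sum>t<n. idmat n i t * idmat n t j) = (if i = j then 1 else 0)"
    by (simp add: idmat_def)
qed

lemma span_idmat:
  assumes "\<And>a. a \<ge> n \<Longrightarrow> v a = 0"
  shows "v \<in> cv.span (mcol (idmat n) ` {..<n})"
proof -
  have "v = (\<lambda>a. \<Sum>t<n. v t * mcol (idmat n) t a)"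
  proof
    fix a show "v a = (\<Sum>t<n. v t * mcol (idmat n) t a)"
      using assms[of a] by (cases "a < n") (auto simp: mcol_def idmat_def if_distrib cong: if_cong)
  qed
  then show ?thesis unfolding span_family_iff by blast
qed

lemma span_mcol_full:
  assumes "mdet n M \<noteq> 0" "\<And>a p. a \<ge> n \<Longrightarrow> M a p = 0"
  shows "cv.span (mcol M ` {..<n}) = cv.span (mcol (idmat n) ` {..<n})"
proof (rule span_mcol_eq_of_dim[OF assms(1)])
  show "mcol M ` {..<n} \<subseteq> cv.span (mcol (idmat n) ` {..<n})"
    using assms(2) by (intro image_subsetI span_idmat) (simp add: mcol_def)
qed (simp_all add: dim_mcol[OF mdet_idmat])

text \<open>The coefficients that express the unit vectors by the columns of \<open>M\<close> form a
  right inverse.\<close>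

lemma mdet_nonzero_of_span:
  assumes "cv.span (mcol (idmat n) ` {..<n}) \<subseteq> cv.span (mcol M ` {..<n})"
  shows "mdet n M \<noteq> 0"
proof -
  have "\<exists>c. mcol (idmat n) j = (\<lambda>a. \<Sum>t<n. c t * mcol M t a)" if "j < n" for j
  proof -
    have "mcol (idmat n) j \<in> cv.span (mcol (idmat n) ` {..<n})" using that by (intro cv.span_base) auto
    then have "mcol (idmat n) j \<in> cv.span (mcol M ` {..<n})" using assms by blast
    then show ?thesis by (simp only: span_family_iff)
  qed
  then obtain c where c: "\<And>j. j < n \<Longrightarrow> mcol (idmat n) j = (\<lambda>a. \<Sum>t<n. c j t * mcol M t a)"
    by metis
  show ?thesis
  proof (rule mdet_nonzeroI[where L = "\<lambda>t j. c j t"])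
    fix i j assume ij: "i < n" "j < n"
    show "(\<Sum>t<n. M i t * c j t) = (if i = j then 1 else 0)"
      using fun_cong[OF c[OF ij(2)], of i] ij by (auto simp: mcol_def idmat_def mult.commute)
  qed
qed

section \<open>Charts of an orbit\<close>

lemma rk_mono: "i \<le> i' \<Longrightarrow> rk N m i j \<le> rk N m i' j"
  unfolding rk_def by (rule sum_mono2) auto

lemma rk_Suc: "j \<le> N \<Longrightarrow> rk N m i j = rk N m i (Suc j) + (\<Sum>k\<le>i. m k j)"
  by (simp add: rk_def sum.atLeast_Suc_atMost[of j N] sum.distrib add.commute)

text \<open>\<open>frame d \<sigma> A n\<close> is a moving basis of the \<open>n\<close>-th space: its columns are selected by \<open>\<sigma>\<close> from
  the images of the previous basis, completed by constant unit vectors.  In the chart coordinates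
  the same basis is read off directly (\<open>cframe\<close>).\<close>

fun frame :: "(nat \<Rightarrow> nat) \<Rightarrow> (nat \<Rightarrow> nat \<Rightarrow> nat) \<Rightarrow> (nat \<Rightarrow> nat \<Rightarrow> nat \<Rightarrow> complex) \<Rightarrow> nat \<Rightarrow> nat \<Rightarrow> nat \<Rightarrow> complex" where
  "frame d \<sigma> A 0 = idmat (d 0)"
| "frame d \<sigma> A (Suc n) = (\<lambda>a p. if a < d (Suc n) \<and> p < d (Suc n) then
     (if \<sigma> n p < d n then mmult (A (Suc n)) (frame d \<sigma> A n) (d n) a (\<sigma> n p)
      else if a = \<sigma> n p - d n then 1 else 0) else 0)"

fun cframe :: "(nat \<Rightarrow> nat) \<Rightarrow> (nat \<Rightarrow> nat \<Rightarrow> nat) \<Rightarrow> (nat \<Rightarrow> nat \<Rightarrow> nat \<Rightarrow> complex) \<Rightarrow> nat \<Rightarrow> nat \<Rightarrow> nat \<Rightarrow> complex" where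
  "cframe d \<sigma> x 0 = idmat (d 0)"
| "cframe d \<sigma> x (Suc n) = (\<lambda>a p. if a < d (Suc n) \<and> p < d (Suc n) then
     (if \<sigma> n p < d n then x (Suc n) a (\<sigma> n p)
      else if a = \<sigma> n p - d n then 1 else 0) else 0)"

declare frame.simps(2) [simp del] cframe.simps(2) [simp del]

lemma Rep_zero: "A \<in> Rep N d \<Longrightarrow> \<not> (1 \<le> i \<and> i \<le> N \<and> a < d i \<and> b < d (i - 1)) \<Longrightarrow> A i a b = 0"
  unfolding Rep_def by blast

lemma frame_zero: "a \<ge> d n \<Longrightarrow> frame d \<sigma> A n a p = 0"
  by (cases n) (auto simp: idmat_def frame.simps cframe.simps)

lemma cframe_zero: "a \<ge> d n \<Longrightarrow> cframe d \<sigma> A n a p = 0"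
  by (cases n) (auto simp: idmat_def frame.simps cframe.simps)

text \<open>A value \<open>\<sigma> n p < d n\<close> makes the image of frame vector
  \<open>\<sigma> n p\<close> the p-th vector of the next frame; a larger value inserts the unit
  vector with index \<open>\<sigma> n p - d n\<close>. The last assumption orders each frame by
  birth: among the new vectors, the first \<open>r i (Suc n)\<close> are exactly the chosen images
  of the first \<open>r i n\<close> old ones.\<close>

locale orbit_chart =
  fixes N :: nat and d :: "nat \<Rightarrow> nat" and m :: "nat \<Rightarrow> nat \<Rightarrow> nat" and \<sigma> :: "nat \<Rightarrow> nat \<Rightarrow> nat"
  assumes kost: "m \<in> kostant N d"
    and \<sigma>_inj: "n < N \<Longrightarrow> inj_on (\<sigma> n) {..<d (Suc n)}"
    and \<sigma>_rk: "n < N \<Longrightarrow> i \<le> n \<Longrightarrow> p < d (Suc n) \<Longrightarrow> \<sigma> n p < rk N m i n \<longleftrightarrow> p < rk N m i (Suc n)"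
begin

abbreviation "r \<equiv> rk N m"
abbreviation "fr \<equiv> frame d \<sigma>"
abbreviation "cf \<equiv> cframe d \<sigma>"

text \<open>Below \<open>d n\<close> these are the selected vectors, whose images enter the next
  frame; values from \<open>d n\<close> on only stand for unit vectors.\<close>

definition "J n = \<sigma> n ` {..<d (Suc n)}"

text \<open>The least i is the birth of vector q. Its image lies in the image of the i-th space,
  hence uses only this many leading vectors of the next frame.\<close>

definition "ht n q = r (LEAST i. q < r i n) (Suc n)"

text \<open>Positions of the free coordinates: for a selected q, \<open>a\<close> runs over the rows
  of its image vector; otherwise it runs over the leading vectors of the next frame.\<close>

definition "K = {(i, a, q). 1 \<le> i \<and> i \<le> N \<and> q < d (i - 1) \<and>
  a < (if q \<in> J (i - 1) then d i else ht (i - 1) q)}"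

text \<open>The columns of \<open>Bx\<close> are the images of the frame vectors, rebuilt from the
  coordinates; \<open>Ax\<close> then multiplies by the inverse frame to return to the standard
  basis.\<close>

definition "Bx x n = (\<lambda>a q. if q \<in> J n then x (Suc n) a q
  else \<Sum>t<ht n q. cf x (Suc n) a t * x (Suc n) t q)"

definition "Ax x = (\<lambda>i a b. if 1 \<le> i \<and> i \<le> N \<and> a < d i \<and> b < d (i - 1)
  then \<Sum>q<d (i - 1). Bx x (i - 1) a q * minv (d (i - 1)) (cf x (i - 1)) q b else 0)"

definition "BA A n = mmult (A (Suc n)) (fr A n) (d n)"

text \<open>Reads the coordinates off a point. The columns that are not selected are expressed in
  the next frame and truncated to their height; \<open>coeff_zero\<close> shows that on the orbit
  nothing is lost.\<close>

definition "Xc A = (\<lambda>i a q. if (i, a, q) \<in> K then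
  (if q \<in> J (i - 1) then BA A (i - 1) a q
   else \<Sum>t<d i. minv (d i) (fr A i) a t * BA A (i - 1) t q) else 0)"

definition "U = {A \<in> orbit N d m. \<forall>n\<le>N. mdet (d n) (fr A n) \<noteq> 0}"

definition "ZK = {x :: nat \<Rightarrow> nat \<Rightarrow> nat \<Rightarrow> complex. \<forall>i a q. x i a q \<noteq> 0 \<longrightarrow> (i, a, q) \<in> K}"

definition "\<Omega> = {x \<in> ZK. \<forall>n\<le>N. mdet (d n) (cf x n) \<noteq> 0}"

lemma r_diag: "n \<le> N \<Longrightarrow> r n n = d n"
  using kostant_rk[OF kost] .

lemma r_le: "i \<le> n \<Longrightarrow> n \<le> N \<Longrightarrow> r i n \<le> d n"
  using rk_mono[of i n N m n] r_diag by simp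

lemma J_cases:
  assumes "n < N" "q \<in> J n"
  obtains p where "p < d (Suc n)" "q = \<sigma> n p" "\<And>i. i \<le> n \<Longrightarrow> q < r i n \<longleftrightarrow> p < r i (Suc n)"
  using assms \<sigma>_rk unfolding J_def by blast

lemma ht_le:
  assumes "q < r i n"
  shows "ht n q \<le> r i (Suc n)"
  unfolding ht_def by (intro rk_mono Least_le assms)

lemma birth:
  assumes "n < N" "q < d n"
  obtains i where "i \<le> n" "q < r i n" "ht n q = r i (Suc n)"
proof -
  have "q < r n n" using assms r_diag by simp
  then show ?thesis
    using LeastI[of "\<lambda>i. q < r i n" n] Least_le[of "\<lambda>i. q < r i n" n] that unfolding ht_def by blast
qed

lemma ht_le_d: "n < N \<Longrightarrow> q < d n \<Longrightarrow> ht n q \<le> d (Suc n)"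
  by (metis birth r_le Suc_leI le_SucI)

lemma fr_col:
  assumes "n < N" "p < d (Suc n)" "\<sigma> n p < d n" "A \<in> Rep N d"
  shows "mcol (fr A (Suc n)) p = mcol (BA A n) (\<sigma> n p)"
proof
  fix a
  have "A (Suc n) a t = 0" if "a \<ge> d (Suc n)" for t
    using Rep_zero[OF assms(4), of "Suc n" a t] that by simp
  then show "mcol (fr A (Suc n)) p a = mcol (BA A n) (\<sigma> n p) a"
    using assms by (auto simp: mcol_def BA_def mmult_def frame.simps)
qed

lemma BA_col: "mcol (BA A n) q = mat_vec (A (Suc n)) (d n) (mcol (fr A n) q)"
  by (simp add: BA_def mcol_mmult)

lemma span_chain_Suc:
  assumes "cv.span (mcol (fr A n) ` {..<k}) = cv.span (mcol (chain A d i (n - i)) ` {..<d i})" "i \<le> n"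
  shows "cv.span (mcol (BA A n) ` {..<k}) = cv.span (mcol (chain A d i (Suc n - i)) ` {..<d i})"
proof -
  have "chain A d i (Suc n - i) = mmult (A (Suc n)) (chain A d i (n - i)) (d n)"
    using assms(2) by (simp add: Suc_diff_le)
  then have "mcol (chain A d i (Suc n - i)) ` {..<d i}
      = mat_vec (A (Suc n)) (d n) ` mcol (chain A d i (n - i)) ` {..<d i}"
    by (simp add: mcol_mmult image_image)
  moreover have "mcol (BA A n) ` {..<k} = mat_vec (A (Suc n)) (d n) ` mcol (fr A n) ` {..<k}"
    by (simp add: BA_col image_image)
  ultimately show ?thesis using span_mat_vec_image[OF assms(1)] by simp
qed

lemma span_fr_diag:
  assumes "mdet (d n) (fr A n) \<noteq> 0" "n \<le> N"
  shows "cv.span (mcol (fr A n) ` {..<r n n}) = cv.span (mcol (chain A d n (n - n)) ` {..<d n})"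
  using span_mcol_full[OF assms(1)] frame_zero[of d n] r_diag[OF assms(2)] by simp

text \<open>Induction on n. By the ordering of the frame, its first \<open>r i (Suc n)\<close>
  vectors are images of the first \<open>r i n\<close> previous ones, so they lie in the image of
  the composite map. They are independent, and their number is the rank prescribed by the orbit. For
  i = n both sides are the whole space.\<close>

lemma span_fr_orbit:
  assumes A: "A \<in> U" and "i \<le> n" "n \<le> N"
  shows "cv.span (mcol (fr A n) ` {..<r i n}) = cv.span (mcol (chain A d i (n - i)) ` {..<d i})"
  using assms(2,3)
proof (induction n)
  case 0
  then show ?case using span_fr_diag[of 0 A] mdet_idmat[of "d 0"] by simp
next
  case (Suc n)
  have det: "mdet (d (Suc n)) (fr A (Suc n)) \<noteq> 0" using A Suc.prems by (simp add: U_def)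
  have Rep: "A \<in> Rep N d" using A by (simp add: U_def orbit_def)
  show ?case
  proof (cases "i = Suc n")
    case True
    then show ?thesis using span_fr_diag[OF det] Suc.prems by simp
  next
    case False
    then have i: "i \<le> n" using Suc.prems by simp
    have IH: "cv.span (mcol (BA A n) ` {..<r i n}) = cv.span (mcol (chain A d i (Suc n - i)) ` {..<d i})"
      using Suc.IH i Suc.prems by (intro span_chain_Suc) auto
    show ?thesis
    proof (rule span_mcol_eq_of_dim[OF det])
      show "r i (Suc n) \<le> d (Suc n)" using r_le Suc.prems by blast
      show "mcol (fr A (Suc n)) ` {..<r i (Suc n)} \<subseteq> cv.span (mcol (chain A d i (Suc n - i)) ` {..<d i})"
      proof (rule image_subsetI)
        fix p assume p: "p \<in> {..<r i (Suc n)}"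
        then have pd: "p < d (Suc n)" using \<open>r i (Suc n) \<le> d (Suc n)\<close> by simp
        have "\<sigma> n p < r i n" using \<sigma>_rk[of n i p] p pd i Suc.prems by simp
        moreover from this have "\<sigma> n p < d n" using r_le[of i n] i Suc.prems by simp
        ultimately have "mcol (fr A (Suc n)) p \<in> mcol (BA A n) ` {..<r i n}"
          using fr_col[OF _ pd _ Rep] Suc.prems by auto
        then show "mcol (fr A (Suc n)) p \<in> cv.span (mcol (chain A d i (Suc n - i)) ` {..<d i})"
          unfolding IH[symmetric] by (rule cv.span_base)
      qed
      show "cv.dim (mcol (chain A d i (Suc n - i)) ` {..<d i}) = r i (Suc n)"
        using A i Suc.prems by (simp add: U_def orbit_def mrank_eq)
    qed simp
  qed
qed

text \<open>By \<open>span_fr_orbit\<close> the image of q is a combination of the first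
  \<open>ht n q\<close> vectors of the next frame, and coordinates with respect to a basis are
  unique.\<close>

lemma coeff_zero:
  assumes A: "A \<in> U" and n: "n < N" and q: "q < d n" and a: "ht n q \<le> a" "a < d (Suc n)"
  shows "(\<Sum>t<d (Suc n). minv (d (Suc n)) (fr A (Suc n)) a t * BA A n t q) = 0"
proof -
  let ?E = "fr A (Suc n)" and ?D = "d (Suc n)"
  have det: "mdet ?D ?E \<noteq> 0" using A n by (simp add: U_def)
  obtain i where i: "i \<le> n" "q < r i n" "ht n q = r i (Suc n)" using birth[OF n q] by blast
  have "mcol (BA A n) q \<in> cv.span (mcol (BA A n) ` {..<r i n})" using i by (intro cv.span_base) auto
  also have "\<dots> = cv.span (mcol (chain A d i (Suc n - i)) ` {..<d i})"
    using i n by (intro span_chain_Suc span_fr_orbit[OF A]) auto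
  also have "\<dots> = cv.span (mcol ?E ` {..<ht n q})"
    using span_fr_orbit[OF A, of i "Suc n"] i n by simp
  finally obtain c where c: "\<And>t. BA A n t q = (\<Sum>s<ht n q. c s * ?E t s)"
    unfolding span_family_iff mcol_def by metis
  have "(\<Sum>t<?D. minv ?D ?E a t * BA A n t q) = (\<Sum>t<?D. \<Sum>s<ht n q. c s * (minv ?D ?E a t * ?E t s))"
    unfolding c by (simp add: sum_distrib_left ac_simps)
  also have "\<dots> = (\<Sum>s<ht n q. c s * (\<Sum>t<?D. minv ?D ?E a t * ?E t s))"
    by (subst sum.swap) (simp add: sum_distrib_left)
  also have "\<dots> = 0"
  proof (intro sum.neutral ballI)
    fix s assume "s \<in> {..<ht n q}"
    then have "s < ?D" "a \<noteq> s" using a by auto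
    then show "c s * (\<Sum>t<?D. minv ?D ?E a t * ?E t s) = 0" using minv_left[OF det a(2)] by simp
  qed
  finally show ?thesis .
qed

lemma Xc_pivot:
  assumes "A \<in> U" "n < N" "q < d n" "q \<in> J n"
  shows "Xc A (Suc n) a q = BA A n a q"
proof (cases "a < d (Suc n)")
  case True
  then show ?thesis using assms by (simp add: Xc_def K_def)
next
  case False
  then have "A (Suc n) a t = 0" for t
    using assms(1) Rep_zero[of A N d "Suc n" a t] by (simp add: U_def orbit_def)
  then have "BA A n a q = 0" by (simp add: BA_def mmult_def)
  then show ?thesis using False assms by (simp add: Xc_def K_def)
qed

lemma cf_Xc:
  assumes "A \<in> U" "n \<le> N"
  shows "cf (Xc A) n = fr A n"
proof (cases n)
  case 0
  then show ?thesis by simp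
next
  case (Suc k)
  have "Xc A (Suc k) a (\<sigma> k p) = mmult (A (Suc k)) (fr A k) (d k) a (\<sigma> k p)"
    if "p < d (Suc k)" "\<sigma> k p < d k" for a p
    using Xc_pivot[OF assms(1), of k "\<sigma> k p" a] that assms Suc by (simp add: J_def BA_def)
  then show ?thesis by (auto simp: Suc fun_eq_iff frame.simps cframe.simps)
qed

lemma Bx_Xc:
  assumes A: "A \<in> U" and n: "n < N" and q: "q < d n"
  shows "Bx (Xc A) n a q = BA A n a q"
proof (cases "q \<in> J n")
  case True
  then show ?thesis using Xc_pivot[OF A n q] by (simp add: Bx_def)
next
  case False
  let ?D = "d (Suc n)"
  let ?c = "\<lambda>s. \<Sum>t<?D. minv ?D (fr A (Suc n)) s t * BA A n t q"
  have det: "mdet ?D (fr A (Suc n)) \<noteq> 0" using A n by (simp add: U_def)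
  have "Bx (Xc A) n a q = (\<Sum>t<ht n q. fr A (Suc n) a t * Xc A (Suc n) t q)"
    using False cf_Xc[OF A, of "Suc n"] n by (simp only: Bx_def if_False)
  also have "\<dots> = (\<Sum>t<ht n q. fr A (Suc n) a t * ?c t)"
    using False q n by (intro sum.cong refl) (simp add: Xc_def K_def)
  also have "\<dots> = (\<Sum>t<?D. fr A (Suc n) a t * ?c t)"
    using ht_le_d[OF n q] coeff_zero[OF A n q]
    by (intro sum.mono_neutral_left) auto
  also have "\<dots> = BA A n a q"
  proof (cases "a < ?D")
    case True
    then show ?thesis by (rule minv_expand[OF det])
  next
    case False
    then have "A (Suc n) a t = 0" for t
      using A Rep_zero[of A N d "Suc n" a t] by (simp add: U_def orbit_def)
    then have "BA A n a q = 0" by (simp add: BA_def mmult_def)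
    then show ?thesis using False frame_zero[of d "Suc n" a] by simp
  qed
  finally show ?thesis .
qed

lemma Ax_Xc:
  assumes A: "A \<in> U"
  shows "Ax (Xc A) = A"
proof (intro ext)
  fix i a b
  show "Ax (Xc A) i a b = A i a b"
  proof (cases "1 \<le> i \<and> i \<le> N \<and> a < d i \<and> b < d (i - 1)")
    case True
    then obtain n where n: "i = Suc n" "n < N" "b < d n" by (cases i) auto
    have det: "mdet (d n) (fr A n) \<noteq> 0" using A n by (simp add: U_def)
    have "Ax (Xc A) i a b = (\<Sum>q<d n. BA A n a q * minv (d n) (fr A n) q b)"
      using True n cf_Xc[OF A, of n] Bx_Xc[OF A n(2)] by (simp add: Ax_def)
    also have "\<dots> = (\<Sum>q<d n. \<Sum>t<d n. A i a t * (fr A n t q * minv (d n) (fr A n) q b))"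
      by (simp add: BA_def mmult_def n sum_distrib_right mult.assoc)
    also have "\<dots> = (\<Sum>t<d n. A i a t * (\<Sum>q<d n. fr A n t q * minv (d n) (fr A n) q b))"
      by (subst sum.swap) (simp add: sum_distrib_left)
    also have "\<dots> = (\<Sum>t<d n. if t = b then A i a t else 0)"
      using n by (intro sum.cong refl) (simp add: minv_right[OF det])
    also have "\<dots> = A i a b" using n by simp
    finally show ?thesis .
  next
    case False
    then have "A i a b = 0" using A Rep_zero[of A N d i a b] unfolding U_def orbit_def by blast
    then show ?thesis using False by (auto simp: Ax_def)
  qed
qed

lemma Xc_in: "A \<in> U \<Longrightarrow> Xc A \<in> \<Omega>"
  using cf_Xc by (auto simp: \<Omega>_def ZK_def U_def Xc_def)

lemma \<Omega>_zero: "x \<in> \<Omega> \<Longrightarrow> (i, a, q) \<notin> K \<Longrightarrow> x i a q = 0"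
  by (auto simp: \<Omega>_def ZK_def)

lemma Ax_Rep: "Ax x \<in> Rep N d"
  by (auto simp: Rep_def Ax_def)

text \<open>This is \<open>(B E^-1) E = B\<close>. That the frame of \<open>Ax x\<close> equals the
  one read off from \<open>x\<close> is assumed at level n only, so that \<open>fr_Ax\<close> can
  alternate between the two facts in its induction.\<close>

lemma BA_Ax:
  assumes x: "x \<in> \<Omega>" and n: "n < N" and q: "q < d n" and fr: "fr (Ax x) n = cf x n"
  shows "BA (Ax x) n a q = Bx x n a q"
proof (cases "a < d (Suc n)")
  case True
  have det: "mdet (d n) (cf x n) \<noteq> 0" using x n by (simp add: \<Omega>_def)
  have "BA (Ax x) n a q = (\<Sum>t<d n. (\<Sum>s<d n. Bx x n a s * minv (d n) (cf x n) s t) * cf x n t q)"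
    unfolding BA_def mmult_def fr using True n by (intro sum.cong refl) (simp add: Ax_def)
  also have "\<dots> = (\<Sum>t<d n. \<Sum>s<d n. Bx x n a s * (minv (d n) (cf x n) s t * cf x n t q))"
    by (simp add: sum_distrib_right mult.assoc)
  also have "\<dots> = (\<Sum>s<d n. Bx x n a s * (\<Sum>t<d n. minv (d n) (cf x n) s t * cf x n t q))"
    by (subst sum.swap) (simp add: sum_distrib_left)
  also have "\<dots> = (\<Sum>s<d n. if s = q then Bx x n a s else 0)"
    using q by (intro sum.cong refl) (simp add: minv_left[OF det])
  also have "\<dots> = Bx x n a q" using q by simp
  finally show ?thesis .
next
  case False
  then have "Ax x (Suc n) a t = 0" for t
    using Rep_zero[OF Ax_Rep, of "Suc n" a t] by simp
  then have "BA (Ax x) n a q = 0" by (simp add: BA_def mmult_def)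
  moreover have "x (Suc n) a q = 0" if "q \<in> J n"
    using \<Omega>_zero[OF x, of "Suc n" a q] False that by (simp add: K_def)
  then have "Bx x n a q = 0" using False cframe_zero[of d "Suc n" a] by (simp add: Bx_def)
  ultimately show ?thesis by simp
qed

lemma fr_Ax:
  assumes x: "x \<in> \<Omega>" and "n \<le> N"
  shows "fr (Ax x) n = cf x n"
  using assms(2)
proof (induction n)
  case 0
  then show ?case by simp
next
  case (Suc n)
  have "mmult (Ax x (Suc n)) (fr (Ax x) n) (d n) a (\<sigma> n p) = x (Suc n) a (\<sigma> n p)"
    if "p < d (Suc n)" "\<sigma> n p < d n" for a p
    using BA_Ax[OF x, of n "\<sigma> n p" a] Suc that by (simp add: BA_def Bx_def J_def)
  then show ?case by (auto simp: fun_eq_iff frame.simps cframe.simps)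
qed

lemma det_fr_Ax: "x \<in> \<Omega> \<Longrightarrow> n \<le> N \<Longrightarrow> mdet (d n) (fr (Ax x) n) \<noteq> 0"
  using fr_Ax[of x n] by (simp add: \<Omega>_def)

text \<open>Here no ranks are known in advance. Instead the images of the first \<open>r i n\<close>
  frame vectors are compared with the first \<open>r i (Suc n)\<close> new ones: a selected vector
  maps to one of these, any other maps to a combination of the first \<open>ht n q\<close> of them,
  and conversely each of these is such an image. The ranks required in \<open>Ax_in\<close>
  follow.\<close>

lemma span_fr_Ax:
  assumes x: "x \<in> \<Omega>" and "i \<le> n" "n \<le> N"
  shows "cv.span (mcol (fr (Ax x) n) ` {..<r i n}) = cv.span (mcol (chain (Ax x) d i (n - i)) ` {..<d i})"
  using assms(2,3)
proof (induction n)
  case 0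
  then show ?case using span_fr_diag[of 0 "Ax x"] mdet_idmat[of "d 0"] by simp
next
  case (Suc n)
  show ?case
  proof (cases "i = Suc n")
    case True
    then show ?thesis using span_fr_diag[OF det_fr_Ax[OF x]] Suc.prems by simp
  next
    case False
    then have i: "i \<le> n" and n: "n < N" using Suc.prems by simp_all
    have rd: "r i n \<le> d n" "r i (Suc n) \<le> d (Suc n)" using r_le i Suc.prems by auto
    note frc = fr_col[OF n _ _ Ax_Rep]
    have "mcol (BA (Ax x) n) ` {..<r i n} \<subseteq> cv.span (mcol (fr (Ax x) (Suc n)) ` {..<r i (Suc n)})"
    proof (rule image_subsetI)
      fix q assume "q \<in> {..<r i n}"
      then have q: "q < r i n" by simp
      show "mcol (BA (Ax x) n) q \<in> cv.span (mcol (fr (Ax x) (Suc n)) ` {..<r i (Suc n)})"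
      proof (cases "q \<in> J n")
        case True
        obtain p where p: "p < d (Suc n)" "q = \<sigma> n p" "\<And>i. i \<le> n \<Longrightarrow> q < r i n \<longleftrightarrow> p < r i (Suc n)"
          using J_cases[OF n True] by blast
        then have "p < r i (Suc n)" using q i by simp
        moreover have "mcol (BA (Ax x) n) q = mcol (fr (Ax x) (Suc n)) p"
          using frc[of p x] p q rd by simp
        ultimately show ?thesis by (intro cv.span_base) auto
      next
        case False
        have "mcol (BA (Ax x) n) q
            = (\<lambda>a. \<Sum>t<ht n q. x (Suc n) t q * mcol (fr (Ax x) (Suc n)) t a)"
        proof
          fix a
          have "BA (Ax x) n a q = Bx x n a q"
            using BA_Ax[OF x n] fr_Ax[OF x] q rd n by simp
          then show "mcol (BA (Ax x) n) q a
            = (\<Sum>t<ht n q. x (Suc n) t q * mcol (fr (Ax x) (Suc n)) t a)"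
            using False fr_Ax[OF x, of "Suc n"] n by (simp add: mcol_def Bx_def mult.commute)
        qed
        then have "mcol (BA (Ax x) n) q \<in> cv.span (mcol (fr (Ax x) (Suc n)) ` {..<ht n q})"
          unfolding span_family_iff by (rule exI[where x = "\<lambda>t. x (Suc n) t q"])
        also have "\<dots> \<subseteq> cv.span (mcol (fr (Ax x) (Suc n)) ` {..<r i (Suc n)})"
          using ht_le[OF q] by (intro cv.span_mono image_mono) auto
        finally show ?thesis .
      qed
    qed
    moreover have "mcol (fr (Ax x) (Suc n)) ` {..<r i (Suc n)} \<subseteq> cv.span (mcol (BA (Ax x) n) ` {..<r i n})"
    proof (rule image_subsetI)
      fix p assume "p \<in> {..<r i (Suc n)}"
      then have p: "p < d (Suc n)" "p < r i (Suc n)" using rd by auto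
      then have s: "\<sigma> n p < r i n" using \<sigma>_rk[OF n i] by simp
      then have "mcol (fr (Ax x) (Suc n)) p = mcol (BA (Ax x) n) (\<sigma> n p)"
        using p rd by (intro frc) auto
      then show "mcol (fr (Ax x) (Suc n)) p \<in> cv.span (mcol (BA (Ax x) n) ` {..<r i n})"
        using s by (auto intro: cv.span_base)
    qed
    ultimately have "cv.span (mcol (fr (Ax x) (Suc n)) ` {..<r i (Suc n)}) = cv.span (mcol (BA (Ax x) n) ` {..<r i n})"
      by (intro antisym cv.span_minimal cv.subspace_span)
    also have "\<dots> = cv.span (mcol (chain (Ax x) d i (Suc n - i)) ` {..<d i})"
      using Suc.IH i n by (intro span_chain_Suc) auto
    finally show ?thesis .
  qed
qed

lemma Ax_in:
  assumes x: "x \<in> \<Omega>"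
  shows "Ax x \<in> U"
proof -
  have "mrank (chain (Ax x) d i (j - i)) (d i) = r i j" if "i < j" "j \<le> N" for i j
  proof -
    have "mrank (chain (Ax x) d i (j - i)) (d i) = cv.dim (mcol (fr (Ax x) j) ` {..<r i j})"
      unfolding mrank_eq using span_fr_Ax[OF x, of i j] that cv.span_eq_dim by (metis less_imp_le)
    also have "\<dots> = r i j"
      using that r_le by (intro dim_mcol[OF det_fr_Ax[OF x]]) auto
    finally show ?thesis .
  qed
  then show ?thesis using Ax_Rep det_fr_Ax[OF x] by (simp add: U_def orbit_def)
qed

lemma Xc_Ax:
  assumes x: "x \<in> \<Omega>"
  shows "Xc (Ax x) = x"
proof (intro ext)
  fix i a q
  show "Xc (Ax x) i a q = x i a q"
  proof (cases "(i, a, q) \<in> K")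
    case True
    then obtain n where n: "i = Suc n" "n < N" "q < d n" by (cases i) (auto simp: K_def)
    have BA: "BA (Ax x) n a q = Bx x n a q" for a using BA_Ax[OF x n(2,3)] fr_Ax[OF x] n by simp
    show ?thesis
    proof (cases "q \<in> J n")
      case J: True
      then show ?thesis using True n BA by (simp add: Xc_def Bx_def)
    next
      case False
      let ?D = "d (Suc n)"
      have fr: "fr (Ax x) (Suc n) = cf x (Suc n)" using fr_Ax[OF x] n by simp
      have det: "mdet ?D (cf x (Suc n)) \<noteq> 0" using x n by (simp add: \<Omega>_def)
      have a: "a < ht n q" using True n False by (simp add: K_def)
      then have aD: "a < ?D" using ht_le_d n by force
      have "Xc (Ax x) i a q = (\<Sum>t<?D. minv ?D (cf x (Suc n)) a t * (\<Sum>s<ht n q. cf x (Suc n) t s * x (Suc n) s q))"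
        using True n False BA fr by (simp add: Xc_def Bx_def)
      also have "\<dots> = (\<Sum>t<?D. \<Sum>s<ht n q. minv ?D (cf x (Suc n)) a t * cf x (Suc n) t s * x (Suc n) s q)"
        by (simp add: sum_distrib_left mult.assoc)
      also have "\<dots> = (\<Sum>s<ht n q. (\<Sum>t<?D. minv ?D (cf x (Suc n)) a t * cf x (Suc n) t s) * x (Suc n) s q)"
        by (subst sum.swap) (simp add: sum_distrib_right)
      also have "\<dots> = (\<Sum>s<ht n q. if a = s then x (Suc n) s q else 0)"
        using ht_le_d[OF n(2,3)] by (intro sum.cong refl) (simp add: minv_left[OF det aD])
      also have "\<dots> = x i a q" using a n by simp
      finally show ?thesis .
    qed
  next
    case False
    then show ?thesis using \<Omega>_zero[OF x] by (simp add: Xc_def)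
  qed
qed

end

section \<open>Continuity of the chart maps and passage to real coordinates\<close>

lemma continuous_on_if_const:
  "(P \<Longrightarrow> continuous_on S f) \<Longrightarrow> (\<not> P \<Longrightarrow> continuous_on S g) \<Longrightarrow> continuous_on S (\<lambda>x. if P then f x else g x)"
  by (cases P) auto

lemma continuous_on_coord:
  "continuous_on S (\<lambda>x :: nat \<Rightarrow> nat \<Rightarrow> nat \<Rightarrow> complex. x i a b)"
proof -
  have 1: "continuous_on S (\<lambda>x :: nat \<Rightarrow> nat \<Rightarrow> nat \<Rightarrow> complex. x i)"
    by (rule continuous_on_subset[OF continuous_on_product_coordinates]) simp
  show ?thesis
    by (rule continuous_on_product_then_coordinatewise[OF continuous_on_product_then_coordinatewise[OF 1]])
qed

lemma continuous_on_coordI: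
  fixes f :: "'a::topological_space \<Rightarrow> nat \<Rightarrow> nat \<Rightarrow> nat \<Rightarrow> complex"
  assumes "\<And>i a b. continuous_on S (\<lambda>x. f x i a b)"
  shows "continuous_on S f"
  by (rule continuous_on_coordinatewise_then_product)+ (rule assms)

lemma continuous_on_frame: "continuous_on S (\<lambda>A. frame d \<sigma> A n a p)"
proof (induction n arbitrary: a p)
  case 0
  then show ?case by simp
next
  case (Suc n)
  show ?case
    unfolding frame.simps mmult_def
    by (intro continuous_on_if_const continuous_intros continuous_on_coord Suc)
qed

lemma continuous_on_cframe: "continuous_on S (\<lambda>x. cframe d \<sigma> x n a p)"
  by (cases n) (simp_all add: cframe.simps continuous_on_if_const continuous_on_coord)

text \<open>An enumeration \<open>e\<close> of \<open>K\<close> places the real and the imaginary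
  part of the j-th complex coordinate at the real positions 2j and 2j + 1.\<close>

lemma homeomorphism_finite_support:
  fixes K :: "(nat \<times> nat \<times> nat) set"
  assumes K: "finite K"
  defines "Z \<equiv> {x :: nat \<Rightarrow> nat \<Rightarrow> nat \<Rightarrow> complex. \<forall>i a q. x i a q \<noteq> 0 \<longrightarrow> (i, a, q) \<in> K}"
  obtains f g where "homeomorphism Z {y :: nat \<Rightarrow> real. \<forall>i\<ge>2 * card K. y i = 0} f g"
proof -
  define D where "D = card K"
  obtain e where e: "bij_betw e {..<D} K"
    using ex_bij_betw_nat_finite[OF K] by (auto simp: D_def atLeast0LessThan)
  define e' where "e' = the_inv_into {..<D} e"
  have e'e: "e' (e i) = i" if "i < D" for i
    using e that unfolding e'_def by (intro the_inv_into_f_f) (auto simp: bij_betw_def)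
  have ee': "e (e' k) = k" "e' k < D" if "k \<in> K" for k
    using e that f_the_inv_into_f_bij_betw[OF e] the_inv_into_into[of e "{..<D}" k "{..<D}"]
    unfolding e'_def by (auto simp: bij_betw_def)
  have eK: "e i \<in> K" if "i < D" for i using e that by (auto simp: bij_betw_def)
  define f where "f x i = (if i < 2 * D then
      (case e (i div 2) of (n, a, q) \<Rightarrow> if even i then Re (x n a q) else Im (x n a q)) else 0)"
    for x :: "nat \<Rightarrow> nat \<Rightarrow> nat \<Rightarrow> complex" and i
  define g where "g y n a q = (if (n, a, q) \<in> K then
      Complex (y (2 * e' (n, a, q))) (y (2 * e' (n, a, q) + 1)) else 0)" for y :: "nat \<Rightarrow> real" and n a q
  have "homeomorphism Z {y :: nat \<Rightarrow> real. \<forall>i\<ge>2 * card K. y i = 0} f g"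
  proof (rule homeomorphismI)
    show "continuous_on Z f"
    proof (rule continuous_on_coordinatewise_then_product)
      fix i
      obtain n a q where "e (i div 2) = (n, a, q)" by (cases "e (i div 2)") auto
      then show "continuous_on Z (\<lambda>x. f x i)"
        unfolding f_def
        by (simp only: prod.case) (intro continuous_on_if_const continuous_intros continuous_on_coord)
    qed
    show "continuous_on {y. \<forall>i\<ge>2 * card K. y i = 0} g"
    proof (rule continuous_on_coordI)
      fix n a q
      have "continuous_on S (\<lambda>y. y i)" for S :: "(nat \<Rightarrow> real) set" and i
        by (rule continuous_on_subset[OF continuous_on_product_coordinates]) simp
      then show "continuous_on {y. \<forall>i\<ge>2 * card K. y i = 0} (\<lambda>y. g y n a q)"
        unfolding g_def Complex_eq by (cases "(n, a, q) \<in> K") (auto intro!: continuous_intros)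
    qed
    show "f ` Z \<subseteq> {y. \<forall>i\<ge>2 * card K. y i = 0}" by (auto simp: f_def D_def)
    show "g ` {y. \<forall>i\<ge>2 * card K. y i = 0} \<subseteq> Z" 
      unfolding Z_def by (rule image_subsetI) (simp add: g_def)
    show "g (f x) = x" if "x \<in> Z" for x
    proof (intro ext)
      fix n a q
      show "g (f x) n a q = x n a q"
      proof (cases "(n, a, q) \<in> K")
        case True
        then show ?thesis using ee'[OF True] by (simp add: f_def g_def)
      next
        case False
        then show ?thesis using that by (auto simp: g_def Z_def)
      qed
    qed
    show "f (g y) = y" if "y \<in> {y. \<forall>i\<ge>2 * card K. y i = 0}" for y
    proof
      fix i
      show "f (g y) i = y i"
      proof (cases "i < 2 * D")
        case True
        then have i: "i div 2 < D" by simp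
        obtain n a q where naq: "e (i div 2) = (n, a, q)" by (cases "e (i div 2)") auto
        have "(n, a, q) \<in> K" "e' (n, a, q) = i div 2" using eK[OF i] e'e[OF i] naq by auto
        then show ?thesis using True naq by (cases "even i") (auto simp: f_def g_def)
      next
        case False
        then show ?thesis using that by (simp add: f_def D_def)
      qed
    qed
  qed
  then show ?thesis using that by blast
qed

context orbit_chart
begin

lemma continuous_on_BA: "continuous_on S (\<lambda>A. BA A n a q)"
  unfolding BA_def mmult_def
  by (intro continuous_intros continuous_on_coord continuous_on_frame)

lemma continuous_on_Bx: "continuous_on S (\<lambda>x. Bx x n a q)"
  unfolding Bx_def
  by (cases "q \<in> J n") (auto intro!: continuous_intros continuous_on_coord continuous_on_cframe)

lemma continuous_on_Xc: "continuous_on U Xc"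
proof (rule continuous_on_coordI)
  fix i a q
  show "continuous_on U (\<lambda>A. Xc A i a q)"
  proof (cases "(i, a, q) \<in> K")
    case True
    then have "i \<le> N" by (simp add: K_def)
    then have "continuous_on U (\<lambda>A. minv (d i) (fr A i) a t)" for t
      by (intro continuous_on_minv continuous_on_frame) (simp add: U_def)
    then show ?thesis using True unfolding Xc_def
      by (cases "q \<in> J (i - 1)") (simp_all, (intro continuous_intros continuous_on_BA)+)
  next
    case False
    then show ?thesis by (simp add: Xc_def)
  qed
qed

lemma continuous_on_Ax: "continuous_on \<Omega> Ax"
proof (rule continuous_on_coordI)
  fix i a b
  show "continuous_on \<Omega> (\<lambda>x. Ax x i a b)"
  proof (cases "1 \<le> i \<and> i \<le> N \<and> a < d i \<and> b < d (i - 1)")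
    case True
    then have "continuous_on \<Omega> (\<lambda>x. minv (d (i - 1)) (cf x (i - 1)) q b)" for q
      by (intro continuous_on_minv continuous_on_cframe) (auto simp: \<Omega>_def)
    moreover have "(\<lambda>x. Ax x i a b) = (\<lambda>x. \<Sum>q<d (i - 1). Bx x (i - 1) a q * minv (d (i - 1)) (cf x (i - 1)) q b)"
      using True by (auto simp: Ax_def)
    ultimately show ?thesis
      by (simp only:) (intro continuous_intros continuous_on_Bx)
  next
    case False
    then have "(\<lambda>x. Ax x i a b) = (\<lambda>x. 0)" by (auto simp: Ax_def)
    then show ?thesis by (simp only: continuous_on_const)
  qed
qed

lemma homeomorphism_chart: "homeomorphism U \<Omega> Xc Ax"
  using continuous_on_Xc continuous_on_Ax Xc_in Ax_in Ax_Xc Xc_Ax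
  by (intro homeomorphismI) auto

lemma openin_U: "openin (top_of_set (orbit N d m)) U"
proof -
  have "open (\<Inter>n\<in>{..N}. {A. mdet (d n) (fr A n) \<noteq> 0})"
    by (intro open_INT ballI open_Collect_neq continuous_on_mdet continuous_on_frame continuous_on_const) auto
  moreover have "U = orbit N d m \<inter> (\<Inter>n\<in>{..N}. {A. mdet (d n) (fr A n) \<noteq> 0})"
    by (auto simp: U_def)
  ultimately show ?thesis by (simp add: openin_open_Int)
qed

lemma openin_\<Omega>: "openin (top_of_set ZK) \<Omega>"
proof -
  have "open (\<Inter>n\<in>{..N}. {x. mdet (d n) (cf x n) \<noteq> 0})"
    by (intro open_INT ballI open_Collect_neq continuous_on_mdet continuous_on_cframe continuous_on_const) auto
  moreover have "\<Omega> = ZK \<inter> (\<Inter>n\<in>{..N}. {x. mdet (d n) (cf x n) \<noteq> 0})"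
    by (auto simp: \<Omega>_def)
  ultimately show ?thesis by (simp add: openin_open_Int)
qed

section \<open>Counting the chart coordinates\<close>

definition "col_height n q = (if q \<in> J n then d (Suc n) else ht n q)"

lemma K_eq_image: "K = (\<lambda>(n, q, a). (Suc n, a, q)) ` (SIGMA n:{..<N}. SIGMA q:{..<d n}. {..<col_height n q})"
proof (intro subset_antisym subsetI)
  fix z assume z: "z \<in> K"
  then obtain n a q where naq: "z = (Suc n, a, q)" "n < N" "q < d n" "a < col_height n q"
  proof -
    assume *: "\<And>n a q. z = (Suc n, a, q) \<Longrightarrow> n < N \<Longrightarrow> q < d n \<Longrightarrow> a < col_height n q \<Longrightarrow> thesis"
    obtain i a q where "z = (i, a, q)" by (cases z) auto
    then show ?thesis using z *[of "i - 1" a q] by (cases i; cases "q \<in> J (i - 1)") (auto simp: K_def col_height_def)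
  qed
  then show "z \<in> (\<lambda>(n, q, a). (Suc n, a, q)) ` (SIGMA n:{..<N}. SIGMA q:{..<d n}. {..<col_height n q})"
    by (intro image_eqI[of _ _ "(n, q, a)"]) auto
next
  fix z assume "z \<in> (\<lambda>(n, q, a). (Suc n, a, q)) ` (SIGMA n:{..<N}. SIGMA q:{..<d n}. {..<col_height n q})"
  then obtain n a q where "z = (Suc n, a, q)" "n < N" "q < d n" "a < col_height n q" by auto
  then show "z \<in> K" by (cases "q \<in> J n") (simp_all add: K_def col_height_def)
qed

lemma finite_K: "finite K"
  unfolding K_eq_image by (intro finite_imageI finite_SigmaI) auto

lemma card_K: "card K = (\<Sum>n<N. \<Sum>q<d n. col_height n q)"
proof -
  have "inj_on (\<lambda>(n, q, a). (Suc n, a, q)) (SIGMA n:{..<N}. SIGMA q:{..<d n}. {..<col_height n q})"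
    by (auto simp: inj_on_def)
  then have "card K = card (SIGMA n:{..<N}. SIGMA q:{..<d n}. {..<col_height n q})"
    unfolding K_eq_image by (rule card_image)
  also have "\<dots> = (\<Sum>n<N. card (SIGMA q:{..<d n}. {..<col_height n q}))"
    by (rule card_SigmaI) auto
  also have "\<dots> = (\<Sum>n<N. \<Sum>q<d n. col_height n q)"
    by (intro sum.cong refl) simp
  finally show ?thesis .
qed

lemma card_J:
  assumes n: "n < N" and i: "i \<le> n"
  shows "card ({..<r i n} \<inter> J n) = r i (Suc n)"
proof -
  have le: "r i (Suc n) \<le> d (Suc n)" using r_le[of i "Suc n"] n i by simp
  have "{..<r i n} \<inter> J n = \<sigma> n ` {..<r i (Suc n)}"
  proof (intro subset_antisym subsetI)
    fix q assume "q \<in> {..<r i n} \<inter> J n"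
    then have q: "q < r i n" "q \<in> J n" by auto
    obtain p where "q = \<sigma> n p" "\<And>i. i \<le> n \<Longrightarrow> q < r i n \<longleftrightarrow> p < r i (Suc n)"
      using J_cases[OF n q(2)] by blast
    then show "q \<in> \<sigma> n ` {..<r i (Suc n)}" using q(1) i by auto
  next
    fix q assume "q \<in> \<sigma> n ` {..<r i (Suc n)}"
    then obtain p where "q = \<sigma> n p" "p < r i (Suc n)" by auto
    then show "q \<in> {..<r i n} \<inter> J n" using \<sigma>_rk[OF n i, of p] le by (auto simp: J_def)
  qed
  moreover have "inj_on (\<sigma> n) {..<r i (Suc n)}"
    by (rule inj_on_subset[OF \<sigma>_inj[OF n]]) (use le in auto)
  ultimately show ?thesis by (simp add: card_image)
qed

text \<open>The vectors of birth at most i that are not selected correspond to the intervals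
  starting at or before i and ending at n, since these account for
  \<open>r i n - r i (Suc n)\<close>.\<close>

lemma card_nonpivot:
  assumes n: "n < N" and i: "i \<le> n"
  shows "card ({..<r i n} - J n) = (\<Sum>k\<le>i. m k n)"
  using card_Diff_subset_Int[of "{..<r i n}" "J n"] card_J[OF n i] rk_Suc[of n N m i] n by simp

lemma ht_Suc:
  assumes "r i n \<le> q" "q < r (Suc i) n"
  shows "ht n q = r (Suc i) (Suc n)"
proof -
  have "(LEAST j. q < r j n) = Suc i"
  proof (rule Least_equality)
    fix j assume "q < r j n"
    then have "\<not> j \<le> i" using rk_mono[of j i N m n] assms(1) by auto
    then show "Suc i \<le> j" by simp
  qed (rule assms(2))
  then show ?thesis by (simp add: ht_def)
qed

lemma ht_0:
  assumes "q < r 0 n"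
  shows "ht n q = r 0 (Suc n)"
  unfolding ht_def using Least_equality[of "\<lambda>j. q < r j n" 0] assms by simp

text \<open>Exactly \<open>m i n\<close> unselected vectors have birth i, namely those between
  positions \<open>r (i - 1) n\<close> and \<open>r i n\<close> (from 0 if i = 0), and all of them
  have height \<open>r i (Suc n)\<close>.\<close>

lemma sum_ht_nonpivot:
  assumes n: "n < N" and i: "i \<le> n"
  shows "(\<Sum>q\<in>{..<r i n} - J n. ht n q) = (\<Sum>k\<le>i. m k n * r k (Suc n))"
  using i
proof (induction i)
  case 0
  have "(\<Sum>q\<in>{..<r 0 n} - J n. ht n q) = (\<Sum>q\<in>{..<r 0 n} - J n. r 0 (Suc n))"
    by (intro sum.cong refl ht_0) auto
  then show ?case using card_nonpivot[OF n, of 0] by simp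
next
  case (Suc i)
  let ?A = "{..<r i n} - J n" and ?B = "{r i n..<r (Suc i) n} - J n"
  have mono: "r i n \<le> r (Suc i) n" by (rule rk_mono) simp
  have un: "{..<r (Suc i) n} - J n = ?A \<union> ?B" using mono by auto
  have "card ({..<r (Suc i) n} - J n) = card ?A + card ?B"
    unfolding un by (rule card_Un_disjoint) auto
  then have B: "card ?B = m (Suc i) n"
    using card_nonpivot[OF n, of i] card_nonpivot[OF n, of "Suc i"] Suc.prems by simp
  have "(\<Sum>q\<in>?B. ht n q) = (\<Sum>q\<in>?B. r (Suc i) (Suc n))"
    by (intro sum.cong refl ht_Suc) auto
  then have "(\<Sum>q\<in>?B. ht n q) = m (Suc i) n * r (Suc i) (Suc n)" using B by simp
  moreover have "(\<Sum>q\<in>{..<r (Suc i) n} - J n. ht n q) = (\<Sum>q\<in>?A. ht n q) + (\<Sum>q\<in>?B. ht n q)"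
    unfolding un by (rule sum.union_disjoint) auto
  ultimately show ?case using Suc by simp
qed

text \<open>For each n, \<open>d n\<close> splits into \<open>r n (Suc n)\<close> selected columns,
  of full height \<open>d (Suc n)\<close>, and \<open>m i n\<close> unselected columns of birth i,
  of height \<open>r i (Suc n)\<close>. The missing heights add up to the n-th part of
  \<open>cdim\<close>.\<close>

lemma dimRep_eq: "dimRep N d = card K + cdim N d m"
proof -
  have "(\<Sum>q<d n. col_height n q) + (\<Sum>i\<le>n. m i n * (d (Suc n) - r i (Suc n))) = d (Suc n) * d n" if n: "n < N" for n
  proof -
    have dn: "d n = r n n" using r_diag[of n] n by simp
    have "(\<Sum>q<d n. col_height n q) = (\<Sum>q\<in>{..<d n} \<inter> J n. col_height n q) + (\<Sum>q\<in>{..<d n} - J n. col_height n q)"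
      by (rule sum.Int_Diff) simp
    also have "(\<Sum>q\<in>{..<d n} \<inter> J n. col_height n q) = (\<Sum>q\<in>{..<d n} \<inter> J n. d (Suc n))"
      by (intro sum.cong) (auto simp: col_height_def)
    also have "\<dots> = r n (Suc n) * d (Suc n)"
      using card_J[OF n, of n] dn by simp
    also have "(\<Sum>q\<in>{..<d n} - J n. col_height n q) = (\<Sum>q\<in>{..<r n n} - J n. ht n q)"
      unfolding dn by (intro sum.cong) (auto simp: col_height_def)
    also have "\<dots> = (\<Sum>i\<le>n. m i n * r i (Suc n))"
      by (rule sum_ht_nonpivot[OF n]) simp
    finally have "(\<Sum>q<d n. col_height n q) + (\<Sum>i\<le>n. m i n * (d (Suc n) - r i (Suc n)))
      = r n (Suc n) * d (Suc n) + (\<Sum>i\<le>n. m i n * r i (Suc n) + m i n * (d (Suc n) - r i (Suc n)))"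
      by (simp add: sum.distrib)
    also have "(\<Sum>i\<le>n. m i n * r i (Suc n) + m i n * (d (Suc n) - r i (Suc n))) = (\<Sum>i\<le>n. m i n * d (Suc n))"
    proof (intro sum.cong refl)
      fix i assume "i \<in> {..n}"
      then have "r i (Suc n) \<le> d (Suc n)" using r_le[of i "Suc n"] n by simp
      then show "m i n * r i (Suc n) + m i n * (d (Suc n) - r i (Suc n)) = m i n * d (Suc n)"
        by (simp flip: distrib_left)
    qed
    also have "r n (Suc n) * d (Suc n) + (\<Sum>i\<le>n. m i n * d (Suc n)) = d (Suc n) * d n"
      using rk_Suc[of n N m n] n dn by (simp add: distrib_left mult.commute sum_distrib_left)
    finally show ?thesis .
  qed
  then have "card K + cdim N d m = (\<Sum>n<N. d (Suc n) * d n)"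
    unfolding card_K cdim_def sum.distrib[symmetric] by (intro sum.cong) auto
  moreover have "dimRep N d = (\<Sum>n<N. d (Suc n) * d n)"
    unfolding dimRep_def by (rule sum.reindex_bij_witness[of _ Suc "\<lambda>i. i - 1"]) auto
  ultimately show ?thesis by simp
qed

lemma euclidean_chart:
  "\<exists>V f g. openin (top_of_set {y :: nat \<Rightarrow> real. \<forall>i\<ge>2 * card K. y i = 0}) V \<and> homeomorphism U V f g"
proof -
  obtain f g where fg: "homeomorphism ZK {y :: nat \<Rightarrow> real. \<forall>i\<ge>2 * card K. y i = 0} f g"
    unfolding ZK_def by (rule homeomorphism_finite_support[OF finite_K])
  have "openin (top_of_set {y :: nat \<Rightarrow> real. \<forall>i\<ge>2 * card K. y i = 0}) (f ` \<Omega>)"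
    using homeomorphism_imp_open_map[OF fg openin_\<Omega>] .
  moreover have "homeomorphism \<Omega> (f ` \<Omega>) f g"
    using openin_imp_subset[OF openin_\<Omega>] by (rule homeomorphism_of_subsets[OF fg]) auto
  then have "homeomorphism U (f ` \<Omega>) (f \<circ> Xc) (Ax \<circ> g)"
    by (rule homeomorphism_compose[OF homeomorphism_chart])
  ultimately show ?thesis by blast
qed

end

section \<open>Existence of charts\<close>

text \<open>For the increasing enumeration the positions with value below t form an initial segment,
  which is determined by its size. In this form it yields the locale assumption on
  \<open>\<sigma>\<close>.\<close>

lemma finite_nat_set_enum:
  fixes G :: "nat set"
  assumes G: "finite G"
  obtains s where "bij_betw s {..<card G} G"
    "\<And>p t. p < card G \<Longrightarrow> s p < t \<longleftrightarrow> p < card (G \<inter> {..<t})"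
proof -
  obtain s where s: "strict_mono_on {..<card G} s" "\<And>n. n < card G \<Longrightarrow> s n \<in> G"
    using finite_enumerate[OF G] by metis
  have inj: "inj_on s {..<card G}" using s(1) by (rule strict_mono_on_imp_inj_on)
  have "s ` {..<card G} = G"
    using s(2) by (intro card_subset_eq[OF G]) (auto simp: card_image[OF inj])
  then have bij: "bij_betw s {..<card G} G" using inj by (simp add: bij_betw_def)
  have "s p < t \<longleftrightarrow> p < card (G \<inter> {..<t})" if p: "p < card G" for p t
  proof -
    define X where "X = {p \<in> {..<card G}. s p < t}"
    have "G \<inter> {..<t} = s ` X" using \<open>s ` {..<card G} = G\<close> by (auto simp: X_def)
    moreover have "inj_on s X" using inj by (rule inj_on_subset) (auto simp: X_def)
    ultimately have card: "card (G \<inter> {..<t}) = card X" by (simp add: card_image)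
    have fin: "finite X" by (simp add: X_def)
    have down: "p' \<in> X" if "p \<in> X" "p' \<le> p" for p p'
    proof -
      have p: "p < card G" "s p < t" using that(1) unfolding X_def by auto
      have "s p' \<le> s p"
      proof (cases "p' = p")
        case False
        then have "s p' < s p" using p that(2) by (intro strict_mono_onD[OF s(1)]) auto
        then show ?thesis by simp
      qed simp
      then show ?thesis using p that(2) unfolding X_def by auto
    qed
    have "p \<in> X \<longleftrightarrow> p < card X"
    proof
      assume "p \<in> X"
      then have "{..p} \<subseteq> X" using down by blast
      then have "card {..p} \<le> card X" using fin by (rule card_mono[rotated])
      then show "p < card X" by simp
    next
      assume *: "p < card X"
      show "p \<in> X"
      proof (rule ccontr)
        assume "p \<notin> X"
        then have "X \<subseteq> {..<p}" using down by (metis lessThan_iff not_le subsetI)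
        then have "card X \<le> card {..<p}" by (rule card_mono[rotated]) simp
        with * show False by simp
      qed
    qed
    then show ?thesis using p by (simp add: card X_def)
  qed
  then show ?thesis using that bij by blast
qed

text \<open>The set is built block by block: between \<open>f k\<close> and \<open>f (Suc k)\<close>
  take the first \<open>g (Suc k) - g k\<close> elements, which fit because \<open>g\<close> grows
  no faster than \<open>f\<close>.\<close>

lemma ex_subset_counts:
  fixes f g :: "nat \<Rightarrow> nat"
  assumes "g 0 \<le> f 0"
    and "\<And>i. i < k \<Longrightarrow> f i \<le> f (Suc i) \<and> g i \<le> g (Suc i) \<and> g (Suc i) + f i \<le> f (Suc i) + g i"
  shows "\<exists>J \<subseteq> {..<f k}. \<forall>i\<le>k. card (J \<inter> {..<f i}) = g i"
  using assms(2)
proof (induction k)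
  case 0
  have "{..<g 0} \<inter> {..<f 0} = {..<g 0}" using assms(1) by auto
  then show ?case using assms(1) by (intro exI[of _ "{..<g 0}"]) auto
next
  case (Suc k)
  then obtain J where J: "J \<subseteq> {..<f k}" "\<forall>i\<le>k. card (J \<inter> {..<f i}) = g i" by auto
  have k: "f k \<le> f (Suc k)" "g k \<le> g (Suc k)" "g (Suc k) + f k \<le> f (Suc k) + g k"
    using Suc.prems[of k] by auto
  have mono: "f i \<le> f k" if "i \<le> k" for i
    using that Suc.prems by (induction k rule: dec_induct) (auto intro: order_trans)
  let ?J = "J \<union> {f k..<f k + (g (Suc k) - g k)}"
  have "card (?J \<inter> {..<f i}) = g i" if "i \<le> Suc k" for i
  proof (cases "i = Suc k")
    case True
    have "?J \<inter> {..<f (Suc k)} = (J \<inter> {..<f k}) \<union> {f k..<f k + (g (Suc k) - g k)}" using J(1) k by auto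
    moreover have "card \<dots> = card (J \<inter> {..<f k}) + card {f k..<f k + (g (Suc k) - g k)}"
      by (rule card_Un_disjoint) auto
    ultimately show ?thesis using True J(2) k by simp
  next
    case False
    then have i: "i \<le> k" using that by simp
    then have "?J \<inter> {..<f i} = J \<inter> {..<f i}" using mono[of i] by auto
    then show ?thesis using J(2) i by simp
  qed
  moreover have "?J \<subseteq> {..<f (Suc k)}" using J(1) k by auto
  ultimately show ?case by blast
qed

text \<open>A selection with the right counts is made first; the locale then supplies a chart, and
  it suffices to find one point in its domain. The point is chosen so that all frames become
  identity matrices.\<close>

lemma orbit_nonempty:
  assumes m: "m \<in> kostant N d"
  shows "orbit N d m \<noteq> {}"
proof -
  let ?r = "rk N m"
  have dle: "?r i n \<le> d n" if "i \<le> n" "n \<le> N" for i n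
    using rk_mono[of i n N m n] kostant_rk[OF m, of n] that by simp
  have "\<exists>s. inj_on s {..<d (Suc n)} \<and>
      (\<forall>i\<le>n. \<forall>p<d (Suc n). s p < ?r i n \<longleftrightarrow> p < ?r i (Suc n)) \<and>
      (\<forall>p<d (Suc n). s p < d n \<or> s p = d n + p)" if n: "n < N" for n
  proof -
    let ?\<rho> = "?r n (Suc n)"
    have "\<exists>J \<subseteq> {..<?r n n}. \<forall>i\<le>n. card (J \<inter> {..<?r i n}) = ?r i (Suc n)"
    proof (rule ex_subset_counts)
      show "?r 0 (Suc n) \<le> ?r 0 n" using rk_Suc[of n N m 0] n by simp
      show "?r i n \<le> ?r (Suc i) n \<and> ?r i (Suc n) \<le> ?r (Suc i) (Suc n) \<and>
          ?r (Suc i) (Suc n) + ?r i n \<le> ?r (Suc i) n + ?r i (Suc n)" for i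
        using rk_mono[of i "Suc i" N m n] rk_mono[of i "Suc i" N m "Suc n"] rk_Suc[of n N m i] rk_Suc[of n N m "Suc i"] n by simp
    qed
    then obtain J where J: "J \<subseteq> {..<d n}" "\<And>i. i \<le> n \<Longrightarrow> card (J \<inter> {..<?r i n}) = ?r i (Suc n)"
      using kostant_rk[OF m, of n] n by auto
    have "finite J" using J(1) finite_subset by blast
    have cJ: "card J = ?\<rho>"
      using J(2)[of n] J(1) kostant_rk[OF m, of n] n by (simp add: inf.absorb1)
    obtain s where s: "bij_betw s {..<?\<rho>} J" "\<And>p t. p < ?\<rho> \<Longrightarrow> s p < t \<longleftrightarrow> p < card (J \<inter> {..<t})"
      using finite_nat_set_enum[OF \<open>finite J\<close>] unfolding cJ by blast
    have sd: "s p < d n" if "p < ?\<rho>" for p using s(1) J(1) that by (auto simp: bij_betw_def)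
    \<comment> \<open>Outside the selected part, the value \<open>d n + p\<close> makes the inserted
      unit vector the p-th one, at its own place in the frame.\<close>
    define s' where "s' p = (if p < ?\<rho> then s p else d n + p)" for p
    have "inj_on s' {..<d (Suc n)}"
    proof (rule inj_onI)
      fix p p' assume eq: "s' p = s' p'"
      show "p = p'"
      proof (cases "p < ?\<rho> \<and> p' < ?\<rho>")
        case True
        then show ?thesis
          using eq inj_onD[OF bij_betw_imp_inj_on[OF s(1)], of p p'] by (simp add: s'_def)
      next
        case False
        then show ?thesis using eq sd[of p] sd[of p'] by (cases "p < ?\<rho>"; cases "p' < ?\<rho>") (simp_all add: s'_def)
      qed
    qed
    moreover have "s' p < ?r i n \<longleftrightarrow> p < ?r i (Suc n)" if "i \<le> n" for i p
    proof (cases "p < ?\<rho>")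
      case True
      then show ?thesis using s(2)[OF True, of "?r i n"] J(2)[OF that] by (simp add: s'_def)
    next
      case False
      moreover have "?r i (Suc n) \<le> ?\<rho>" by (rule rk_mono) (rule that)
      moreover have "?r i n \<le> d n" using dle that n by simp
      ultimately show ?thesis by (simp add: s'_def)
    qed
    moreover have "s' p < d n \<or> s' p = d n + p" for p
      using sd[of p] by (simp add: s'_def)
    ultimately show ?thesis by blast
  qed
  then obtain \<sigma> where \<sigma>: "\<And>n. n < N \<Longrightarrow> inj_on (\<sigma> n) {..<d (Suc n)}"
    "\<And>n i p. n < N \<Longrightarrow> i \<le> n \<Longrightarrow> p < d (Suc n) \<Longrightarrow> \<sigma> n p < ?r i n \<longleftrightarrow> p < ?r i (Suc n)"
    "\<And>n p. n < N \<Longrightarrow> p < d (Suc n) \<Longrightarrow> \<sigma> n p < d n \<or> \<sigma> n p = d n + p"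
    by metis
  interpret orbit_chart N d m \<sigma>
    by unfold_locales (use m \<sigma> in auto)
  \<comment> \<open>The selected vector \<open>\<sigma> n a\<close> is sent to the a-th unit vector,
    and all other columns are zero.\<close>
  define x :: "nat \<Rightarrow> nat \<Rightarrow> nat \<Rightarrow> complex" where
    "x i a q = (if 1 \<le> i \<and> i \<le> N \<and> a < d i \<and> q < d (i - 1) \<and> q = \<sigma> (i - 1) a then 1 else 0)" for i a q
  have "x \<in> ZK"
    unfolding ZK_def K_def x_def J_def by auto
  moreover have "cf x n = idmat (d n)" if "n \<le> N" for n
  proof (cases n)
    case 0
    then show ?thesis by simp
  next
    case (Suc k)
    then have k: "k < N" using that by simp
    show ?thesis
    proof (intro ext)
      fix a p
      show "cf x n a p = idmat (d n) a p"
      proof (cases "a < d (Suc k) \<and> p < d (Suc k)")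
        case True
        have "\<sigma> k p = \<sigma> k a \<longleftrightarrow> a = p" using \<sigma>(1)[OF k] True by (auto simp: inj_on_def)
        then show ?thesis using True k \<sigma>(3)[OF k, of p] Suc
          by (auto simp: cframe.simps idmat_def x_def)
      next
        case False
        then show ?thesis using Suc by (auto simp: cframe.simps idmat_def)
      qed
    qed
  qed
  ultimately have "x \<in> \<Omega>" using mdet_idmat by (simp add: \<Omega>_def)
  then have "Ax x \<in> orbit N d m" using Ax_in by (auto simp: U_def)
  then show ?thesis by blast
qed

lemma frame_cong:
  assumes "\<And>k. k < n \<Longrightarrow> \<sigma> k = \<sigma>' k"
  shows "frame d \<sigma> A n = frame d \<sigma>' A n"
  using assms
proof (induction n)
  case (Suc n)
  then have "\<sigma> n = \<sigma>' n" "frame d \<sigma> A n = frame d \<sigma>' A n" by auto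
  then show ?case by (simp only: frame.simps)
qed simp

text \<open>The selections are made one space at a time. The induction also carries the description
  of the images of the composite maps by initial parts of the current frame, because the ranks at
  the next stage are read off from it.\<close>

lemma chart_at:
  assumes m: "m \<in> kostant N d" and A: "A \<in> orbit N d m"
  shows "\<exists>\<sigma>. orbit_chart N d m \<sigma> \<and> (\<forall>n\<le>N. mdet (d n) (frame d \<sigma> A n) \<noteq> 0)"
proof -
  let ?r = "rk N m"
  let ?V = "\<lambda>i n. mcol (chain A d i (n - i)) ` {..<d i}"
  have dle: "?r i n \<le> d n" if "i \<le> n" "n \<le> N" for i n
    using rk_mono[of i n N m n] kostant_rk[OF m, of n] that by simp
  have ex: "\<exists>\<sigma>. (\<forall>n<k. inj_on (\<sigma> n) {..<d (Suc n)}) \<and>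
      (\<forall>n<k. \<forall>i\<le>n. \<forall>p<d (Suc n). \<sigma> n p < ?r i n \<longleftrightarrow> p < ?r i (Suc n)) \<and>
      (\<forall>n\<le>k. mdet (d n) (frame d \<sigma> A n) \<noteq> 0) \<and>
      (\<forall>i\<le>k. cv.span (mcol (frame d \<sigma> A k) ` {..<?r i k}) = cv.span (?V i k))" if "k \<le> N" for k
    using that
  proof (induction k)
    case 0
    then show ?case using mdet_idmat kostant_rk[OF m, of 0] by simp
  next
    case (Suc k)
    then have kN: "k < N" by simp
    obtain \<sigma> where inj: "\<forall>n<k. inj_on (\<sigma> n) {..<d (Suc n)}"
      and rk: "\<forall>n<k. \<forall>i\<le>n. \<forall>p<d (Suc n). \<sigma> n p < ?r i n \<longleftrightarrow> p < ?r i (Suc n)"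
      and det: "\<forall>n\<le>k. mdet (d n) (frame d \<sigma> A n) \<noteq> 0"
      and sp: "\<forall>i\<le>k. cv.span (mcol (frame d \<sigma> A k) ` {..<?r i k}) = cv.span (?V i k)"
      using Suc by auto
    let ?E = "frame d \<sigma> A k" and ?D = "d (Suc k)"
    \<comment> \<open>The images of the current frame come first, then all unit vectors: the greedy
      choice takes as many images as possible, and the family spans the whole next space.\<close>
    define w where "w q = (if q < d k then mat_vec (A (Suc k)) (d k) (mcol ?E q) else mcol (idmat ?D) (q - d k))" for q
    let ?M = "d k + ?D"
    have A0: "A (Suc k) a t = 0" if "a \<ge> ?D" for a t
      using A Rep_zero[of A N d "Suc k" a t] that by (simp add: orbit_def)
    have w0: "w q a = 0" if "a \<ge> ?D" for q a
      using A0 that by (simp add: w_def mat_vec_def mcol_def idmat_def)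
    have wV: "cv.span (w ` {..<?r i k}) = cv.span (?V i (Suc k))" if i: "i \<le> k" for i
    proof -
      have "w ` {..<?r i k} = mat_vec (A (Suc k)) (d k) ` mcol ?E ` {..<?r i k}"
        unfolding image_image using dle[of i k] i kN by (intro image_cong) (auto simp: w_def)
      moreover have "?V i (Suc k) = mat_vec (A (Suc k)) (d k) ` ?V i k"
        using i by (simp add: Suc_diff_le mcol_mmult image_image)
      ultimately show ?thesis using span_mat_vec_image[of "mcol ?E ` {..<?r i k}" "?V i k"] sp i by simp
    qed
    have wM: "cv.span (w ` {..<?M}) = cv.span (mcol (idmat ?D) ` {..<?D})"
    proof (intro antisym cv.span_minimal cv.subspace_span)
      show "w ` {..<?M} \<subseteq> cv.span (mcol (idmat ?D) ` {..<?D})"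
        using w0 by (intro image_subsetI span_idmat)
      show "mcol (idmat ?D) ` {..<?D} \<subseteq> cv.span (w ` {..<?M})"
      proof (rule image_subsetI)
        fix q assume "q \<in> {..<?D}"
        then have "mcol (idmat ?D) q = w (d k + q)" "d k + q \<in> {..<?M}" by (auto simp: w_def)
        then show "mcol (idmat ?D) q \<in> cv.span (w ` {..<?M})" by (auto intro: cv.span_base)
      qed
    qed
    \<comment> \<open>There are as many pivots as the dimension of the next space. Those among the
      first \<open>r i k\<close> positions number \<open>r i (Suc k)\<close>, the rank of the
      composite map; enumerating the pivots increasingly gives the condition on
      \<open>\<sigma>\<close>.\<close>
    define G where "G = pivots w \<inter> {..<?M}"
    have Gt: "G \<inter> {..<t} = pivots w \<inter> {..<t}" if "t \<le> ?M" for t using that by (auto simp: G_def)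
    have cG: "card G = ?D"
      using card_pivots[of w ?M] cv.span_eq_dim[OF wM] dim_mcol[OF mdet_idmat, of ?D ?D] by (simp add: G_def)
    have cGi: "card (G \<inter> {..<?r i k}) = ?r i (Suc k)" if i: "i \<le> k" for i
    proof -
      have "?r i k \<le> ?M" using dle[of i k] i kN by simp
      then have "card (G \<inter> {..<?r i k}) = cv.dim (?V i (Suc k))"
        using card_pivots[of w "?r i k"] cv.span_eq_dim[OF wV[OF i]] Gt by simp
      also have "\<dots> = ?r i (Suc k)"
        using A i kN unfolding orbit_def mrank_eq by simp
      finally show ?thesis .
    qed
    obtain s where s: "bij_betw s {..<?D} G" "\<And>p t. p < ?D \<Longrightarrow> s p < t \<longleftrightarrow> p < card (G \<inter> {..<t})"
      using finite_nat_set_enum[of G] unfolding cG by (auto simp: G_def)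
    define \<sigma>' where "\<sigma>' = \<sigma>(k := s)"
    have fr: "frame d \<sigma>' A n = frame d \<sigma> A n" if "n \<le> k" for n
      using that by (intro frame_cong) (auto simp: \<sigma>'_def)
    have col: "mcol (frame d \<sigma>' A (Suc k)) p = w (s p)" if p: "p < ?D" for p
    proof
      fix a
      have "s p < ?M" using s(1) p by (auto simp: bij_betw_def G_def)
      show "mcol (frame d \<sigma>' A (Suc k)) p a = w (s p) a"
      proof (cases "a < ?D")
        case True
        then show ?thesis using p fr[of k] \<open>s p < ?M\<close>
          by (auto simp: mcol_def frame.simps \<sigma>'_def w_def mmult_def mat_vec_def idmat_def)
      next
        case False
        then show ?thesis using w0 frame_zero[of d "Suc k" a] by (simp add: mcol_def)
      qed
    qed
    have colimg: "mcol (frame d \<sigma>' A (Suc k)) ` {..<t} = w ` s ` {..<t}" if "t \<le> ?D" for t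
      unfolding image_image using that col by (intro image_cong) auto
    have full: "cv.span (mcol (frame d \<sigma>' A (Suc k)) ` {..<?D}) = cv.span (mcol (idmat ?D) ` {..<?D})"
      using colimg[of ?D] s(1) pivots_basis[of w ?M] wM by (simp add: bij_betw_def G_def)
    have part: "cv.span (mcol (frame d \<sigma>' A (Suc k)) ` {..<?r i (Suc k)}) = cv.span (?V i (Suc k))" if i: "i \<le> k" for i
    proof -
      have le: "?r i (Suc k) \<le> ?D" using dle[of i "Suc k"] i kN by simp
      have "s ` {..<?r i (Suc k)} = G \<inter> {..<?r i k}"
      proof (intro subset_antisym subsetI)
        fix q assume "q \<in> s ` {..<?r i (Suc k)}"
        then obtain p where p: "q = s p" "p < ?r i (Suc k)" by auto
        then show "q \<in> G \<inter> {..<?r i k}"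
          using s(1) s(2)[of p "?r i k"] cGi[OF i] le by (auto simp: bij_betw_def)
      next
        fix q assume q: "q \<in> G \<inter> {..<?r i k}"
        then obtain p where p: "q = s p" "p < ?D" using s(1) by (auto simp: bij_betw_def)
        then show "q \<in> s ` {..<?r i (Suc k)}"
          using s(2)[of p "?r i k"] cGi[OF i] q by auto
      qed
      moreover have "?r i k \<le> ?M" using dle[of i k] i kN by simp
      ultimately show ?thesis
        using colimg[OF le] pivots_basis[of w "?r i k"] Gt[of "?r i k"] wV[OF i] by simp
    qed
    have "\<forall>n<Suc k. inj_on (\<sigma>' n) {..<d (Suc n)}"
      using inj s(1) by (auto simp: \<sigma>'_def less_Suc_eq bij_betw_def)
    moreover have "\<forall>n<Suc k. \<forall>i\<le>n. \<forall>p<d (Suc n). \<sigma>' n p < ?r i n \<longleftrightarrow> p < ?r i (Suc n)"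
      using rk s(2) cGi by (auto simp: \<sigma>'_def less_Suc_eq)
    moreover have "\<forall>n\<le>Suc k. mdet (d n) (frame d \<sigma>' A n) \<noteq> 0"
      using det fr mdet_nonzero_of_span[of ?D "frame d \<sigma>' A (Suc k)"] full by (auto simp: le_Suc_eq)
    moreover have "\<forall>i\<le>Suc k. cv.span (mcol (frame d \<sigma>' A (Suc k)) ` {..<?r i (Suc k)}) = cv.span (?V i (Suc k))"
      using part full kostant_rk[OF m, of "Suc k"] kN by (auto simp: le_Suc_eq)
    ultimately show ?case by blast
  qed
  obtain \<sigma> where \<sigma>: "\<forall>n<N. inj_on (\<sigma> n) {..<d (Suc n)}"
    "\<forall>n<N. \<forall>i\<le>n. \<forall>p<d (Suc n). \<sigma> n p < ?r i n \<longleftrightarrow> p < ?r i (Suc n)"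
    "\<forall>n\<le>N. mdet (d n) (frame d \<sigma> A n) \<noteq> 0"
    using ex[OF le_refl] by (elim exE conjE) (rule that; assumption)
  have "orbit_chart N d m \<sigma>" by unfold_locales (use m \<sigma> in auto)
  then show ?thesis using \<sigma>(3) by blast
qed

section \<open>Comparison of the topological codimension with the formula\<close>

lemma codim_orbit:
  assumes m: "m \<in> kostant N d"
  shows "codim N d (orbit N d m) = cdim N d m"
proof -
  define D where "D = dimRep N d - cdim N d m"
  have "locally_euclidean_dim (top_of_set (orbit N d m)) (2 * D)"
  proof (rule locally_euclidean_dimI)
    fix A assume A: "A \<in> orbit N d m"
    obtain \<sigma> where "orbit_chart N d m \<sigma>" and det: "\<forall>n\<le>N. mdet (d n) (frame d \<sigma> A n) \<noteq> 0"
      using chart_at[OF m A] by blast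
    interpret orbit_chart N d m \<sigma> by fact
    have "card K = D" using dimRep_eq by (simp add: D_def)
    moreover have "A \<in> U" using A det by (simp add: U_def)
    ultimately show "\<exists>U V f g. openin (top_of_set (orbit N d m)) U \<and> A \<in> U \<and>
        openin (top_of_set {y :: nat \<Rightarrow> real. \<forall>i\<ge>2 * D. y i = 0}) V \<and> homeomorphism U V f g"
      using openin_U euclidean_chart by auto
  qed
  then have "(THE k. locally_euclidean_dim (top_of_set (orbit N d m)) k) = 2 * D"
    using orbit_nonempty[OF m] by (intro the_locally_euclidean_dim) auto
  \<comment> \<open>Since \<open>D\<close> is a truncated difference, this inequality is what lets
    \<open>dimRep N d - D\<close> return \<open>cdim N d m\<close>.\<close>
  moreover have "cdim N d m \<le> dimRep N d"
  proof -
    obtain A where "A \<in> orbit N d m" using orbit_nonempty[OF m] by blast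
    then obtain \<sigma> where "orbit_chart N d m \<sigma>" using chart_at[OF m] by blast
    then show ?thesis using orbit_chart.dimRep_eq by fastforce
  qed
  ultimately show ?thesis by (simp add: codim_def D_def)
qed

theorem theorem5:
  fixes N r :: nat and d :: "nat \<Rightarrow> nat"
  assumes "N \<ge> 1" and "r \<le> mind N d"
  shows "Qr N d r = PP r * (\<Sum>s\<in>{0..mind N d - r}.
           (-1) ^ s * fps_X ^ (s choose 2) * PP s * (\<Prod>k\<in>{..N}. PP (d k - r - s)))"
proof -
  have "Qr N d r = kostant_sum N d r"
    unfolding Qr_def kostant_sum_def by (intro sum.cong refl) (simp add: codim_orbit)
  then show ?thesis using kostant_sum_formula[OF assms(2)] by simp
qed

end
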